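(* Let $\gamma>1$. There is no non-degenerate $C^2$-smooth TVD field of Glimm type, defined on all of $\mathcal H=\{(r,s)\in\mathbb R^2\mid s>r\}$, for the isentropic gas dynamics system $$\tau_t-u_X=0,\qquad u_t+p(\tau)_X=0,\qquad p(\tau)=\tau^{-\gamma}.$$
   Context: Setting: $\gamma>1$, $\alpha:=\frac{\gamma-1}{2}$, $\kappa:=\frac{\sqrt\gamma}{\alpha}$. The state space of the system is $\{(\tau,u)\mid \tau>0\}$. Put $\xi:=\tau^{-\alpha}>0$ and use the Riemann coordinates $r:=u-\kappa\xi$, $s:=u+\kappa\xi$, which map the state space diffeomorphically onto $\mathcal H:=\{(r,s)\mid s>r\}$ (the no-vacuum region). Scalar fields on state space are regarded as functions $\varphi:\mathcal H\to\mathbb R$ of $(r,s)$. Elementary waves: define $$\Phi_-(x)=\begin{cases}\kappa(x-1),&0<x<1\\ \sqrt{(1-x^{-1/\alpha})(x^{\gamma/\alpha}-1)},&x>1\end{cases}\qquad \Phi_+(x)=\begin{cases}-\sqrt{(1-x^{-1/\alpha})(x^{\gamma/\alpha}-1)},&0<x<1\\ \kappa(x-1),&x>1.\end{cases}$$ A backward wave with left state $(\bar\xi,\bar u)$ and $\xi$-ratio $b=\xi_{\rm right}/\xi_{\rm left}$ has right state $(b\bar\xi,\ \bar u-\Phi_-(b)\bar\xi)$; it is a backward rarefaction if $0<b<1$ and a backward (entropic) shock if $b>1$. A forward wave with left state $(\bar\xi,\bar u)$ and $\xi$-ratio $f$ has right state $(f\bar\xi,\ \bar u+\Phi_+(f)\bar\xi)$;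 it is a forward rarefaction if $f>1$ and a forward (entropic) shock if $0<f<1$. Within a centered rarefaction the states run continuously along the corresponding rarefaction curve. The Riemann problem with left state $(\bar\xi,\bar u)$ and right state $(\xi,u)$ has a unique solution without vacuum, made of a backward wave followed on its right by a forward wave, if and only if $u-\bar u<\kappa(\xi+\bar\xi)$. Glimm-type TVD field: consider two approaching elementary waves with left, middle and right states $U_l,U_m,U_r$, i.e. a wave $(U_l,U_m)$ to the left of a wave $(U_m,U_r)$, where either the left wave is forward and the right wave is backward (head-on interaction), or both belong to the same family and at least one is a shock (overtaking interaction). The interaction is resolved by solving the Riemann problem $(U_l,U_r)$ (interactions whose Riemann problem has a vacuum-free solution). A field $\varphi:\mathcal H\to\mathbb R$ is a Glimm-type TVD field if for every such interaction the total spatial variation of $\varphi$ across the solution of the Riemann problem $(U_l,U_r)$ is less than or equal to the total spatial variation of $\varphi$ across the two incoming waves combined. (The variation across a shock is the absolute value of the jump of $\varphi$; across a rarefaction it is the total variation of $\varphi$ along the states in the rarefaction.) A field $\varphi:\mathcal H\to\mathbb R$ is non-degenerate if the set $\{(r,s)\in\mathcal H\mid \partial_r\varphi(r,s)\neq0\text{ or }\partial_s\varphi(r,s)\neq0\}$ is dense in $\mathcal H$. *)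

theory Defs
  imports "HOL-Analysis.Analysis"
begin

definition alpha :: "real \<Rightarrow> real" where
  "alpha \<gamma> = (\<gamma> - 1) / 2"

definition kappa :: "real \<Rightarrow> real" where
  "kappa \<gamma> = sqrt \<gamma> / alpha \<gamma>"

definition pressure :: "real \<Rightarrow> real \<Rightarrow> real" where
  "pressure \<gamma> \<tau> = \<tau> powr (- \<gamma>)"

text \<open>
  A state of the system \<open>\<tau>\<^sub>t - u\<^sub>X = 0\<close>, \<open>u\<^sub>t + p(\<tau>)\<^sub>X = 0\<close>, \<open>p(\<tau>) = \<tau>\<^sup>-\<^sup>\<gamma>\<close> is a pair
  \<open>(\<xi>, u)\<close> with \<open>\<xi> = \<tau>\<^sup>-\<^sup>\<alpha> > 0\<close>, so that \<open>\<tau> = \<xi>\<^sup>-\<^sup>1\<^sup>/\<^sup>\<alpha>\<close>.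
\<close>

type_synonym state = "real \<times> real"

definition spec_vol :: "real \<Rightarrow> real \<Rightarrow> real" where
  "spec_vol \<gamma> \<xi> = \<xi> powr (- 1 / alpha \<gamma>)"

definition riemann_coords :: "real \<Rightarrow> state \<Rightarrow> real \<times> real" where
  "riemann_coords \<gamma> = (\<lambda>(\<xi>, u). (u - kappa \<gamma> * \<xi>, u + kappa \<gamma> * \<xi>))"

definition no_vacuum :: "(real \<times> real) set" where
  "no_vacuum = {(r, s). s > r}"


text \<open>
  Both branches of the two functions below vanish at \<open>x = 1\<close> (the trivial wave).
\<close>

definition Phi_minus :: "real \<Rightarrow> real \<Rightarrow> real" where
  "Phi_minus \<gamma> x =
    (if x \<le> 1 then kappa \<gamma> * (x - 1)
     else sqrt ((1 - x powr (- 1 / alpha \<gamma>)) * (x powr (\<gamma> / alpha \<gamma>) - 1)))"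

definition Phi_plus :: "real \<Rightarrow> real \<Rightarrow> real" where
  "Phi_plus \<gamma> x =
    (if x < 1 then - sqrt ((1 - x powr (- 1 / alpha \<gamma>)) * (x powr (\<gamma> / alpha \<gamma>) - 1))
     else kappa \<gamma> * (x - 1))"

datatype family = Backward | Forward

fun wave_state :: "real \<Rightarrow> family \<Rightarrow> real \<Rightarrow> state \<Rightarrow> state" where
  "wave_state \<gamma> Backward x (\<xi>, u) = (x * \<xi>, u - Phi_minus \<gamma> x * \<xi>)"
| "wave_state \<gamma> Forward x (\<xi>, u) = (x * \<xi>, u + Phi_plus \<gamma> x * \<xi>)"

fun is_shock :: "family \<Rightarrow> real \<Rightarrow> bool" where
  "is_shock Backward x \<longleftrightarrow> x > 1"
| "is_shock Forward x \<longleftrightarrow> 0 < x \<and> x < 1"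

text \<open>
  Consistency with the system: across a wave that is a shock the Rankine--Hugoniot conditions
  hold, with negative speed for backward and positive speed for forward shocks; across a
  rarefaction the Riemann invariant of the other family is constant.
\<close>

lemma shock_Rankine_Hugoniot:
  assumes "\<gamma> > 1" "\<xi> > 0" "is_shock k x" "wave_state \<gamma> k x (\<xi>, u) = (\<xi>', u')"
  shows "\<exists>\<sigma>. (if k = Backward then \<sigma> < 0 else \<sigma> > 0)
    \<and> - \<sigma> * (spec_vol \<gamma> \<xi>' - spec_vol \<gamma> \<xi>) - (u' - u) = 0
    \<and> - \<sigma> * (u' - u) + (pressure \<gamma> (spec_vol \<gamma> \<xi>') - pressure \<gamma> (spec_vol \<gamma> \<xi>)) = 0"
proof -
  define a where "a = alpha \<gamma>"
  have a: "a > 0" "\<gamma> = 2 * a + 1" using assms(1) by (simp_all add: a_def alpha_def field_simps)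
  define A where "A = 1 - x powr (- 1 / a)"
  define B where "B = x powr (\<gamma> / a) - 1"
  define V where "V = \<xi> powr (- 1 / a)"
  have x: "x > 0" using assms(3) by (cases k) auto
  have V: "V > 0" using assms(2) by (simp add: V_def)
  have e: "- 1 / a < 0" "0 < \<gamma> / a" using a assms(1) by simp_all
  have AB: "(if k = Backward then A > 0 \<and> B > 0 else A < 0 \<and> B < 0)"
  proof (cases k)
    case Backward
    then have "x > 1" using assms(3) by simp
    then have "x powr (- 1 / a) < x powr 0" "x powr 0 < x powr (\<gamma> / a)"
      by (intro powr_less_mono e \<open>x > 1\<close>)+
    then show ?thesis using Backward x by (simp add: A_def B_def)
  next
    case Forward
    then have "x < 1" using assms(3) by simp
    then have "x powr 0 < x powr (- 1 / a)" "x powr (\<gamma> / a) < x powr 0"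
      by (intro powr_less_mono' e x \<open>x < 1\<close>)+
    then show ?thesis using Forward x by (simp add: A_def B_def)
  qed
  have AB0: "A * B > 0" "A \<noteq> 0" using AB by (auto split: if_splits simp: mult_neg_neg)
  have xi': "\<xi>' = x * \<xi>" using assms(4) by (cases k) auto
  have du: "u' - u = - sqrt (A * B) * \<xi>"
    using assms(3,4) by (cases k) (auto simp: Phi_minus_def Phi_plus_def A_def B_def a_def)
  have dv: "spec_vol \<gamma> \<xi>' - spec_vol \<gamma> \<xi> = - V * A"
    using x assms(2)
    by (simp add: spec_vol_def xi' A_def V_def flip: a_def) (simp add: powr_mult algebra_simps)
  have pr: "pressure \<gamma> (spec_vol \<gamma> y) = y powr (\<gamma> / a)" for y
    by (simp add: pressure_def spec_vol_def powr_powr flip: a_def)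
  have "\<xi> powr (\<gamma> / a) * V = \<xi> powr (\<gamma> / a + (- 1 / a))"
    unfolding V_def by (rule powr_add[symmetric])
  also have "\<gamma> / a + (- 1 / a) = 2" using a by (simp add: field_simps)
  finally have \<xi>2: "\<xi> powr (\<gamma> / a) * V = \<xi>\<^sup>2" using assms(2) by simp
  have dp: "pressure \<gamma> (spec_vol \<gamma> \<xi>') - pressure \<gamma> (spec_vol \<gamma> \<xi>) = \<xi> powr (\<gamma> / a) * B"
    using x assms(2) by (simp add: pr xi' B_def powr_mult algebra_simps)
  define \<sigma> where "\<sigma> = - sqrt (A * B) * \<xi> / (V * A)"
  have "(if k = Backward then \<sigma> < 0 else \<sigma> > 0)"
    using AB AB0 V assms(2)
    by (auto simp: \<sigma>_def divide_less_0_iff zero_less_divide_iff zero_less_mult_iff mult_less_0_iff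
        split: if_splits)
  moreover have "- \<sigma> * (- V * A) - (- sqrt (A * B) * \<xi>) = 0"
    using AB0 V by (simp add: \<sigma>_def)
  moreover have "\<sigma> * (- sqrt (A * B) * \<xi>) = \<xi> powr (\<gamma> / a) * B"
  proof -
    have "\<sigma> * (- sqrt (A * B) * \<xi>) = (sqrt (A * B))\<^sup>2 * \<xi>\<^sup>2 / (V * A)"
      by (simp add: \<sigma>_def power2_eq_square)
    also have "\<dots> = (A * B) * (\<xi> powr (\<gamma> / a) * V) / (V * A)"
      using AB0 by (simp add: \<xi>2)
    also have "\<dots> = \<xi> powr (\<gamma> / a) * B" using AB0 V by simp
    finally show ?thesis .
  qed
  ultimately show ?thesis unfolding du dv dp by (intro exI[of _ \<sigma>]) simp
qed

lemma rarefaction_Riemann_invariant: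
  assumes "x > 0" "\<not> is_shock k x"
  shows "(if k = Backward then snd else fst) (riemann_coords \<gamma> (wave_state \<gamma> k x U))
       = (if k = Backward then snd else fst) (riemann_coords \<gamma> U)"
  using assms
  by (cases U; cases k) (auto simp: riemann_coords_def Phi_minus_def Phi_plus_def algebra_simps)


definition total_variation_on :: "(real \<Rightarrow> real) \<Rightarrow> real set \<Rightarrow> ennreal" where
  "total_variation_on g S =
    (SUP (n, t) \<in> {(n :: nat, t). mono_on {..n} t \<and> t ` {..n} \<subseteq> S}.
       \<Sum>i<n. ennreal \<bar>g (t (Suc i)) - g (t i)\<bar>)"

definition wave_variation ::
    "real \<Rightarrow> (real \<times> real \<Rightarrow> real) \<Rightarrow> family \<Rightarrow> real \<Rightarrow> state \<Rightarrow> ennreal" where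
  "wave_variation \<gamma> \<phi> k x U =
    (let \<psi> = (\<lambda>y. \<phi> (riemann_coords \<gamma> (wave_state \<gamma> k y U)))
     in if is_shock k x then ennreal \<bar>\<psi> x - \<phi> (riemann_coords \<gamma> U)\<bar>
        else total_variation_on \<psi> (closed_segment 1 x))"

text \<open>
  A vacuum-free Riemann solution: a backward wave of ratio \<open>b\<close> followed by a forward wave of
  ratio \<open>f\<close>; either may be trivial (ratio 1).
\<close>

definition riemann_solution :: "real \<Rightarrow> state \<Rightarrow> state \<Rightarrow> real \<Rightarrow> real \<Rightarrow> bool" where
  "riemann_solution \<gamma> Ul Ur b f \<longleftrightarrow>
    b > 0 \<and> f > 0 \<and> wave_state \<gamma> Forward f (wave_state \<gamma> Backward b Ul) = Ur"

definition approaching :: "family \<Rightarrow> real \<Rightarrow> family \<Rightarrow> real \<Rightarrow> bool" where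
  "approaching k x k' x' \<longleftrightarrow>
    (k = Forward \<and> k' = Backward) \<or> (k = k' \<and> (is_shock k x \<or> is_shock k' x'))"

definition glimm_TVD :: "real \<Rightarrow> (real \<times> real \<Rightarrow> real) \<Rightarrow> bool" where
  "glimm_TVD \<gamma> \<phi> \<longleftrightarrow>
    (\<forall>Ul Um Ur k x k' x' b f.
       fst Ul > 0 \<and> x > 0 \<and> x \<noteq> 1 \<and> x' > 0 \<and> x' \<noteq> 1 \<and>
       Um = wave_state \<gamma> k x Ul \<and> Ur = wave_state \<gamma> k' x' Um \<and>
       approaching k x k' x' \<and> riemann_solution \<gamma> Ul Ur b f \<longrightarrow>
       wave_variation \<gamma> \<phi> Backward b Ul
         + wave_variation \<gamma> \<phi> Forward f (wave_state \<gamma> Backward b Ul)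
       \<le> wave_variation \<gamma> \<phi> k x Ul + wave_variation \<gamma> \<phi> k' x' Um)"


definition partial_r :: "(real \<times> real \<Rightarrow> real) \<Rightarrow> real \<times> real \<Rightarrow> real" where
  "partial_r \<phi> = (\<lambda>(r, s). deriv (\<lambda>y. \<phi> (y, s)) r)"

definition partial_s :: "(real \<times> real \<Rightarrow> real) \<Rightarrow> real \<times> real \<Rightarrow> real" where
  "partial_s \<phi> = (\<lambda>(r, s). deriv (\<lambda>y. \<phi> (r, y)) s)"

text \<open>\<open>C\<^sup>1\<close> and \<open>C\<^sup>2\<close> on an open set: all partial derivatives exist and are continuous.\<close>

definition C1_on :: "(real \<times> real) set \<Rightarrow> (real \<times> real \<Rightarrow> real) \<Rightarrow> bool" where
  "C1_on S \<phi> \<longleftrightarrow>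
    (\<forall>(r, s) \<in> S. (\<lambda>y. \<phi> (y, s)) field_differentiable at r
                 \<and> (\<lambda>y. \<phi> (r, y)) field_differentiable at s)
    \<and> continuous_on S (partial_r \<phi>) \<and> continuous_on S (partial_s \<phi>)"

definition C2_on :: "(real \<times> real) set \<Rightarrow> (real \<times> real \<Rightarrow> real) \<Rightarrow> bool" where
  "C2_on S \<phi> \<longleftrightarrow> C1_on S \<phi> \<and> C1_on S (partial_r \<phi>) \<and> C1_on S (partial_s \<phi>)"

definition nondegenerate :: "(real \<times> real \<Rightarrow> real) \<Rightarrow> bool" where
  "nondegenerate \<phi> \<longleftrightarrow>
    no_vacuum \<subseteq> closure {p \<in> no_vacuum. partial_r \<phi> p \<noteq> 0 \<or> partial_s \<phi> p \<noteq> 0}"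

end

theory Submission
  imports Defs
begin

text \<open>
  The idea is to reduce an arbitrary TVD field to a linear one by zooming in on the vacuum, where
  linear fields can be ruled out by explicit shock interactions.

  First, weak head-on interactions force \<open>\<phi>\<^sub>r\<^sub>s = 0\<close>. In the \<open>(r, s)\<close> plane a forward wave moves
  along \<open>s\<close> and a backward wave along \<open>r\<close>, up to the cube of the strength when the wave is a
  shock. The four states of a weak interaction are thus almost the corners of a rectangle, and
  the change of variation is a multiple of \<open>\<phi>\<^sub>r\<^sub>s\<close> times its area. The factor depends on the types of
  the waves and on the signs of \<open>\<phi>\<^sub>r\<close> and \<open>\<phi>\<^sub>s\<close>; it is nonzero for a suitable pair of waves, and
  exchanging shocks and rarefactions reverses its sign. So the mixed derivative vanishes
  (\<open>mixed_partial_eq_0\<close>) and \<open>\<phi>(r, s) = A(r) + B(s)\<close>.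

  Secondly, because \<open>\<phi>\<close> is defined on all of the half plane, \<open>A\<close> and \<open>B\<close> are both differentiable
  at every real \<open>q\<close>. The system is invariant under scaling of \<open>(\<xi>, u)\<close> towards the vacuum point
  \<open>(q, q)\<close>. In the limit the TVD inequality for incoming shocks passes to the linear field
  \<open>A'(q) r + B'(q) s\<close> (\<open>linear_field_shock_interaction\<close>).

  Thirdly, no linear field \<open>a r + b s\<close> other than zero satisfies that inequality. If
  \<open>a b \<ge> 0\<close>, overtaking shocks increase the variation, because they reflect a rarefaction
  (\<open>linear_field_overtaking\<close>); if \<open>a b < 0\<close>, symmetric head-on collisions of shocks do, because
  they raise \<open>\<xi>\<close> by more than the incoming shocks lower it (\<open>linear_field_head_on\<close>). Both facts
  come from one property of the shock curve: the slope of its chord increases strictly with the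
  shock strength (\<open>shock_slope_strict_mono\<close>).

  Hence \<open>A' = B' = 0\<close>, and \<open>\<phi>\<close> is constant, which contradicts non-degeneracy.
\<close>

section \<open>The shock curve\<close>

text \<open>
  In the variable \<open>x = exp (2 w)\<close> the function under the root in the shock curve factors into
  hyperbolic sines. With \<open>N = 1 + 1 / \<alpha>\<close> the shock branch becomes
  \<open>(x - 1) sqrt ((sinh (N w) / sinh w)\<^sup>2 - 1)\<close>, so \<open>N\<close> is the only parameter of the curve.
\<close>

definition shock_exponent :: "real \<Rightarrow> real" where
  "shock_exponent \<gamma> = 1 + 1 / alpha \<gamma>"

text \<open>
  The slope of the chord of the shock branch of \<open>\<Phi>\<^sub>-\<close> from \<open>1\<close> to \<open>z > 1\<close>; the
  corresponding slope of the rarefaction branch is the constant \<open>\<kappa>\<close>.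
\<close>

definition shock_slope :: "real \<Rightarrow> real \<Rightarrow> real" where
  "shock_slope \<gamma> z =
    sqrt ((sinh (shock_exponent \<gamma> * (ln z / 2)) / sinh (ln z / 2))\<^sup>2 - 1)"

text \<open>
  Backward and forward waves are mirror images, so one function serves both: it is the drop
  of \<open>u\<close> from left to right across a wave with \<open>\<xi> = x\<close> in front of it (on the left of a backward, on the
  right of a forward wave) and \<open>\<xi> = y\<close> behind it. The wave is a shock iff \<open>y > x\<close>.
\<close>

definition velocity_drop :: "real \<Rightarrow> real \<Rightarrow> real \<Rightarrow> real" where
  "velocity_drop \<gamma> x y = x * Phi_minus \<gamma> (y / x)"

lemma alpha_pos: "\<gamma> > 1 \<Longrightarrow> alpha \<gamma> > 0"
  by (simp add: alpha_def)

lemma shock_exponent_gt_1: "\<gamma> > 1 \<Longrightarrow> shock_exponent \<gamma> > 1"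
  by (simp add: shock_exponent_def alpha_pos)

lemma kappa_pos: "\<gamma> > 1 \<Longrightarrow> kappa \<gamma> > 0"
  by (simp add: kappa_def alpha_pos)

lemma gamma_over_alpha: "\<gamma> > 1 \<Longrightarrow> \<gamma> / alpha \<gamma> = 2 + 1 / alpha \<gamma>"
proof -
  assume "\<gamma> > 1"
  moreover have "\<gamma> = 2 * alpha \<gamma> + 1" unfolding alpha_def by (simp add: field_simps)
  ultimately show ?thesis using alpha_pos[of \<gamma>] by (simp add: field_simps)
qed

lemma kappa_eq: "\<gamma> > 1 \<Longrightarrow> kappa \<gamma> = sqrt ((shock_exponent \<gamma>)\<^sup>2 - 1)"
proof -
  assume g: "\<gamma> > 1"
  have "(kappa \<gamma>)\<^sup>2 = \<gamma> / alpha \<gamma> / alpha \<gamma>"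
    using g by (simp add: kappa_def power_divide power2_eq_square)
  also have "\<dots> = (shock_exponent \<gamma>)\<^sup>2 - 1"
    unfolding gamma_over_alpha[OF g] using alpha_pos[OF g]
    by (simp add: shock_exponent_def power2_eq_square field_simps)
  finally show ?thesis
    using kappa_pos[OF g] by (metis real_sqrt_unique less_imp_le)
qed

text \<open>
  The derivative has the sign of \<open>N cosh (N x) sinh x - sinh (N x) cosh x\<close>, which vanishes at
  \<open>0\<close> and has derivative \<open>(N\<^sup>2 - 1) sinh (N x) sinh x > 0\<close>.
\<close>

lemma sinh_ratio_strict_mono:
  fixes N :: real
  assumes "N > 1" "0 < v" "v < w"
  shows "sinh (N * v) / sinh v < sinh (N * w) / sinh w"
proof -
  define g where "g = (\<lambda>x. N * cosh (N * x) * sinh x - sinh (N * x) * cosh x)"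
  have g_pos: "g x > 0" if "x > 0" for x
  proof -
    have "g 0 < g x"
    proof (rule DERIV_pos_imp_increasing_open[OF that])
      fix y :: real assume "0 < y" "y < x"
      then have "(N\<^sup>2 - 1) * sinh (N * y) * sinh y > 0"
        using assms(1) by (simp add: power2_eq_square less_1_mult)
      moreover have "(g has_real_derivative (N\<^sup>2 - 1) * sinh (N * y) * sinh y) (at y)"
        unfolding g_def by (auto intro!: derivative_eq_intros simp: algebra_simps power2_eq_square)
      ultimately show "\<exists>d. (g has_real_derivative d) (at y) \<and> d > 0" by blast
    qed (auto simp: g_def intro!: continuous_intros)
    then show ?thesis by (simp add: g_def)
  qed
  show ?thesis
  proof (rule DERIV_pos_imp_increasing[OF assms(3)])
    fix x :: real assume "v \<le> x" "x \<le> w"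
    then have x: "x > 0" using assms by simp
    have "((\<lambda>x. sinh (N * x) / sinh x) has_real_derivative g x / (sinh x)\<^sup>2) (at x)"
      using x unfolding g_def
      by (auto intro!: derivative_eq_intros simp: power2_eq_square algebra_simps)
    moreover have "g x / (sinh x)\<^sup>2 > 0" using g_pos[OF x] x by simp
    ultimately show "\<exists>d. ((\<lambda>x. sinh (N * x) / sinh x) has_real_derivative d) (at x) \<and> d > 0"
      by blast
  qed
qed

lemma sinh_ratio_bounds:
  fixes N :: real
  assumes "N > 1" "w > 0"
  shows "N < sinh (N * w) / sinh w" "sinh (N * w) / sinh w \<le> N * cosh (N * w)"
proof -
  have "sinh (N * 0) - N * sinh 0 < sinh (N * w) - N * sinh w"
  proof (rule DERIV_pos_imp_increasing_open[OF assms(2)])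
    fix x :: real assume x: "0 < x" "x < w"
    have "cosh x < cosh (N * x)" using x assms by (simp add: cosh_real_strict_mono)
    then have "N * cosh (N * x) - N * cosh x > 0" using assms by simp
    moreover have "((\<lambda>x. sinh (N * x) - N * sinh x) has_real_derivative
        N * cosh (N * x) - N * cosh x) (at x)"
      by (auto intro!: derivative_eq_intros)
    ultimately show "\<exists>d. ((\<lambda>x. sinh (N * x) - N * sinh x) has_real_derivative d) (at x) \<and> d > 0"
      by blast
  qed (auto intro!: continuous_intros)
  then show "N < sinh (N * w) / sinh w" using assms by (simp add: field_simps)
  have "sinh (N * w) - N * cosh (N * w) * sinh w \<le> sinh (N * 0) - N * cosh (N * w) * sinh 0"
  proof (rule DERIV_nonpos_imp_nonincreasing[where f = "\<lambda>x. sinh (N * x) - N * cosh (N * w) * sinh x"])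
    show "0 \<le> w" using assms by simp
    fix x :: real assume x: "0 \<le> x" "x \<le> w"
    have 1: "cosh (N * x) \<le> cosh (N * w)" using x assms by (simp add: cosh_real_nonneg_le_iff)
    have "cosh (N * w) * 1 \<le> cosh (N * w) * cosh x"
      by (intro mult_left_mono) (simp_all add: cosh_real_ge_1)
    with 1 have "cosh (N * x) \<le> cosh (N * w) * cosh x" by linarith
    then have "N * cosh (N * x) - N * cosh (N * w) * cosh x \<le> 0" using assms
      by simp
    moreover have "((\<lambda>x. sinh (N * x) - N * cosh (N * w) * sinh x) has_real_derivative
        N * cosh (N * x) - N * cosh (N * w) * cosh x) (at x)"
      by (auto intro!: derivative_eq_intros)
    ultimately show "\<exists>d. ((\<lambda>x. sinh (N * x) - N * cosh (N * w) * sinh x)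
        has_real_derivative d) (at x) \<and> d \<le> 0" by blast
  qed
  then show "sinh (N * w) / sinh w \<le> N * cosh (N * w)" using assms by (simp add: field_simps)
qed

text \<open>
  The factorisation behind this is
  \<open>(1 - exp (- 2 h w)) (exp (2 (2 + h) w) - 1) = 4 exp (2 w) sinh (h w) sinh ((2 + h) w)\<close> with
  \<open>h = 1 / \<alpha>\<close>, combined with \<open>sinh (A - B) sinh (A + B) = sinh\<^sup>2 A - sinh\<^sup>2 B\<close> for
  \<open>A = (1 + h) w\<close> and \<open>B = w\<close>.
\<close>

lemma Phi_minus_shock:
  assumes g: "\<gamma> > 1" and z: "z > 1"
  shows "Phi_minus \<gamma> z = (z - 1) * shock_slope \<gamma> z"
proof -
  define h where "h = 1 / alpha \<gamma>"
  define w where "w = ln z / 2"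
  define N where "N = shock_exponent \<gamma>"
  have N: "N = 1 + h" by (simp add: N_def shock_exponent_def h_def)
  have w: "w > 0" using z by (simp add: w_def)
  have sw: "sinh w > 0" using w by simp
  have zw: "z = exp w * exp w" using z by (simp add: w_def flip: exp_add)
  have p: "z powr t = exp (2 * t * w)" for t using z by (simp add: powr_def w_def)
  have z1: "z - 1 = 2 * exp w * sinh w"
    by (simp add: zw sinh_field_def field_simps exp_minus)
  have a: "- 1 / alpha \<gamma> = - h" by (simp add: h_def)
  have "(1 - z powr (- 1 / alpha \<gamma>)) * (z powr (\<gamma> / alpha \<gamma>) - 1)
      = (1 - exp (- 2 * h * w)) * (exp (2 * (2 + h) * w) - 1)"
    unfolding gamma_over_alpha[OF g] a p h_def[symmetric] by simp
  also have "\<dots> = (2 * exp w)\<^sup>2 * ((sinh (N * w))\<^sup>2 - (sinh w)\<^sup>2)"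
  proof -
    define E F where "E = exp w" and "F = exp (h * w)"
    have "exp (- 2 * h * w) = 1 / F ^ 2" "exp (2 * (2 + h) * w) = E ^ 4 * F ^ 2"
      "exp (N * w) = E * F" "exp (- (N * w)) = 1 / (E * F)" "exp (- w) = 1 / E"
      by (simp_all add: E_def F_def N exp_minus field_simps flip: exp_of_nat_mult exp_add)
    moreover have "E > 0" "F > 0" by (simp_all add: E_def F_def)
    ultimately show ?thesis
      by (simp add: sinh_field_def flip: E_def) (simp add: field_simps power2_eq_square power4_eq_xxxx)
  qed
  also have "(sinh (N * w))\<^sup>2 - (sinh w)\<^sup>2
      = (sinh w)\<^sup>2 * ((sinh (N * w) / sinh w)\<^sup>2 - 1)"
    using sw by (simp add: field_simps)
  also have "(2 * exp w)\<^sup>2 * ((sinh w)\<^sup>2 * ((sinh (N * w) / sinh w)\<^sup>2 - 1))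
      = (z - 1)\<^sup>2 * ((sinh (N * w) / sinh w)\<^sup>2 - 1)"
    unfolding z1 by (simp add: power_mult_distrib)
  finally have *: "(1 - z powr (- 1 / alpha \<gamma>)) * (z powr (\<gamma> / alpha \<gamma>) - 1)
      = (z - 1)\<^sup>2 * ((sinh (N * w) / sinh w)\<^sup>2 - 1)" .
  have "Phi_minus \<gamma> z = sqrt ((z - 1)\<^sup>2 * ((sinh (N * w) / sinh w)\<^sup>2 - 1))"
    using z unfolding Phi_minus_def * by simp
  also have "\<dots> = (z - 1) * shock_slope \<gamma> z"
    using z by (simp add: real_sqrt_mult shock_slope_def N_def w_def)
  finally show ?thesis .
qed

lemma shock_slope_strict_mono:
  assumes g: "\<gamma> > 1" and "1 < y" "y < z"
  shows "shock_slope \<gamma> y < shock_slope \<gamma> z"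
proof -
  define N where "N = shock_exponent \<gamma>"
  have N: "N > 1" using g by (simp add: N_def shock_exponent_gt_1)
  have *: "0 < ln y / 2" "ln y / 2 < ln z / 2" using assms by simp_all
  show ?thesis
    unfolding shock_slope_def N_def[symmetric] real_sqrt_less_iff
    using sinh_ratio_strict_mono[OF N *] sinh_ratio_bounds(1)[OF N *(1)] N
    by (simp add: power_strict_mono)
qed

lemma shock_slope_gt_kappa:
  assumes g: "\<gamma> > 1" and "1 < z"
  shows "kappa \<gamma> < shock_slope \<gamma> z"
  unfolding shock_slope_def kappa_eq[OF g] real_sqrt_less_iff
  using sinh_ratio_bounds(1)[of "shock_exponent \<gamma>" "ln z / 2"] assms shock_exponent_gt_1[OF g]
  by (simp add: power_strict_mono)

text \<open>
  The slope differs from its weak limit \<open>\<kappa>\<close> only by a quadratic term. This is the classical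
  second-order contact of the shock curve with the rarefaction curve: the Riemann invariant of
  the other family changes across a shock only by the cube of its strength.
\<close>

lemma shock_slope_upper:
  assumes g: "\<gamma> > 1"
  obtains C where "C > 0" "\<And>z. 1 < z \<Longrightarrow> z \<le> 2 \<Longrightarrow> shock_slope \<gamma> z \<le> kappa \<gamma> + C * (z - 1)\<^sup>2"
proof -
  define N where "N = shock_exponent \<gamma>"
  have N: "N > 1" using g by (simp add: N_def shock_exponent_gt_1)
  define C where "C = (N\<^sup>2 * cosh N)\<^sup>2 / kappa \<gamma>"
  show ?thesis
  proof (rule that[of C])
    show "C > 0" using N kappa_pos[OF g] by (simp add: C_def)
    fix z :: real assume z: "1 < z" "z \<le> 2"
    define w where "w = ln z / 2"
    have w: "w > 0" using z by (simp add: w_def)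
    have w2: "w \<le> z - 1" "w \<le> 1" using z ln_le_minus_one[of z] by (auto simp: w_def)
    define K where "K = sinh (N * w) / sinh w"
    have K: "N < K" "K \<le> N * cosh (N * w)"
      using sinh_ratio_bounds[OF N w] by (auto simp: K_def)
    have ch: "cosh (N * w) \<le> cosh N" using w w2 N by (simp add: cosh_real_nonneg_le_iff)
    have sh: "sinh (N * w) \<le> N * w * cosh N"
    proof -
      have "sinh (N * w) - (N * w) * cosh N \<le> sinh (N * 0) - N * 0 * cosh N"
      proof (rule DERIV_nonpos_imp_nonincreasing[where f = "\<lambda>x. sinh (N * x) - N * x * cosh N"])
        show "0 \<le> w" using w by simp
        fix x :: real assume x: "0 \<le> x" "x \<le> w"
        have "cosh (N * x) \<le> cosh N" using x w2 N by (simp add: cosh_real_nonneg_le_iff)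
        then have "N * cosh (N * x) - N * cosh N \<le> 0" using N by simp
        moreover have "((\<lambda>x. sinh (N * x) - N * x * cosh N) has_real_derivative
            N * cosh (N * x) - N * cosh N) (at x)"
          by (auto intro!: derivative_eq_intros)
        ultimately show "\<exists>d. ((\<lambda>x. sinh (N * x) - N * x * cosh N)
            has_real_derivative d) (at x) \<and> d \<le> 0" by blast
      qed
      then show ?thesis by simp
    qed
    \<comment> \<open>\<open>cosh\<^sup>2 = 1 + sinh\<^sup>2\<close> isolates the quadratic correction.\<close>
    have "K\<^sup>2 \<le> (N * cosh (N * w))\<^sup>2" using K N by (intro power_mono) auto
    also have "\<dots> = N\<^sup>2 + N\<^sup>2 * (sinh (N * w))\<^sup>2"
      by (simp add: power_mult_distrib cosh_square_eq algebra_simps)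
    also have "\<dots> \<le> N\<^sup>2 + N\<^sup>2 * (N * w * cosh N)\<^sup>2"
      using sh w N by (intro add_left_mono mult_left_mono power_mono) auto
    also have "\<dots> = N\<^sup>2 + (N\<^sup>2 * cosh N)\<^sup>2 * w\<^sup>2"
      by (simp add: power_mult_distrib power2_eq_square)
    also have "\<dots> \<le> N\<^sup>2 + (N\<^sup>2 * cosh N)\<^sup>2 * (z - 1)\<^sup>2"
      using w w2 by (intro add_left_mono mult_left_mono power_mono) auto
    finally have K2: "K\<^sup>2 - N\<^sup>2 \<le> (N\<^sup>2 * cosh N)\<^sup>2 * (z - 1)\<^sup>2" by simp
    define S where "S = shock_slope \<gamma> z"
    have S: "S > kappa \<gamma>" using shock_slope_gt_kappa[OF g z(1)] by (simp add: S_def)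
    have "1 * 1 \<le> K * K" using K N by (intro mult_mono) auto
    then have S2: "S\<^sup>2 = K\<^sup>2 - 1"
      by (simp add: S_def shock_slope_def K_def N_def w_def power2_eq_square)
    have "1 * 1 \<le> N * N" using N by (intro mult_mono) auto
    then have k2: "(kappa \<gamma>)\<^sup>2 = N\<^sup>2 - 1" unfolding kappa_eq[OF g] N_def
      by (simp add: power2_eq_square)
    have "(S - kappa \<gamma>) * kappa \<gamma> \<le> (S - kappa \<gamma>) * (S + kappa \<gamma>)"
      using S kappa_pos[OF g] by (intro mult_left_mono) auto
    also have "\<dots> = K\<^sup>2 - N\<^sup>2" using S2 k2 by (simp add: algebra_simps power2_eq_square)
    also note K2
    finally have "S - kappa \<gamma> \<le> C * (z - 1)\<^sup>2"
      using kappa_pos[OF g] by (simp add: C_def field_simps)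
    then show "shock_slope \<gamma> z \<le> kappa \<gamma> + C * (z - 1)\<^sup>2" by (simp add: S_def)
  qed
qed

section \<open>Velocity drops across waves\<close>

lemma velocity_drop_rarefaction:
  "0 < x \<Longrightarrow> y \<le> x \<Longrightarrow> velocity_drop \<gamma> x y = kappa \<gamma> * (y - x)"
  by (simp add: velocity_drop_def Phi_minus_def field_simps)

lemma velocity_drop_shock:
  "\<gamma> > 1 \<Longrightarrow> 0 < x \<Longrightarrow> x < y \<Longrightarrow> velocity_drop \<gamma> x y = (y - x) * shock_slope \<gamma> (y / x)"
  by (simp add: velocity_drop_def Phi_minus_shock field_simps)

lemma velocity_drop_scale:
  "c > 0 \<Longrightarrow> velocity_drop \<gamma> (c * x) (c * y) = c * velocity_drop \<gamma> x y"
  by (simp add: velocity_drop_def)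

lemma velocity_drop_gt_kappa:
  assumes "\<gamma> > 1" "0 < x" "x < y"
  shows "kappa \<gamma> * (y - x) < velocity_drop \<gamma> x y"
  using shock_slope_gt_kappa[of \<gamma> "y / x"] assms by (simp add: velocity_drop_shock)

lemma velocity_drop_ge_kappa:
  assumes "\<gamma> > 1" "0 < x"
  shows "kappa \<gamma> * (y - x) \<le> velocity_drop \<gamma> x y"
  using velocity_drop_gt_kappa[OF assms, of y] velocity_drop_rarefaction[OF assms(2), of y \<gamma>]
  by (cases "x < y") auto

text \<open>
  Both partial chords are less steep than the chord of the combined jump. Hence merging two shocks
  of one family into a single shock would need more velocity drop than the two provide, and the
  surplus has to be carried by a reflected rarefaction.
\<close>

lemma velocity_drop_superadditive:
  assumes g: "\<gamma> > 1" and x: "0 < x" "x < m" "m < y"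
  shows "velocity_drop \<gamma> x m + velocity_drop \<gamma> m y < velocity_drop \<gamma> x y"
proof -
  have "shock_slope \<gamma> (m / x) < shock_slope \<gamma> (y / x)"
    by (rule shock_slope_strict_mono[OF g]) (use x in \<open>auto simp: field_simps\<close>)
  moreover have "shock_slope \<gamma> (y / m) < shock_slope \<gamma> (y / x)"
    by (rule shock_slope_strict_mono[OF g]) (use x in \<open>auto simp: field_simps\<close>)
  ultimately have "(m - x) * shock_slope \<gamma> (m / x) + (y - m) * shock_slope \<gamma> (y / m)
      < (m - x) * shock_slope \<gamma> (y / x) + (y - m) * shock_slope \<gamma> (y / x)"
    using x by (intro add_strict_mono mult_strict_left_mono) auto
  also have "\<dots> = (y - x) * shock_slope \<gamma> (y / x)" by (simp add: algebra_simps)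
  finally show ?thesis using x by (simp add: velocity_drop_shock[OF g])
qed

lemma continuous_on_velocity_drop:
  assumes "x > 0"
  shows "continuous_on {0<..} (velocity_drop \<gamma> x)"
proof -
  have "continuous_on ({..1} \<union> {1..}) (\<lambda>z :: real. if z \<le> 1 then kappa \<gamma> * (z - 1)
     else sqrt ((1 - z powr (- 1 / alpha \<gamma>)) * (z powr (\<gamma> / alpha \<gamma>) - 1)))"
    by (rule continuous_on_If) (auto intro!: continuous_intros)
  moreover have "({..1} \<union> {1..}) = (UNIV :: real set)" by auto
  ultimately have "continuous_on UNIV (Phi_minus \<gamma>)"
    unfolding Phi_minus_def[abs_def] by simp
  then have "continuous_on {0<..} (\<lambda>y. Phi_minus \<gamma> (y / x))"
    by (rule continuous_on_compose2) (use assms in \<open>auto intro!: continuous_intros\<close>)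
  then show ?thesis
    unfolding velocity_drop_def[abs_def] by (intro continuous_intros)
qed

lemma velocity_drop_upper:
  assumes g: "\<gamma> > 1"
  obtains C where "C > 0"
    "\<And>x y. 0 < x \<Longrightarrow> y \<le> 2 * x \<Longrightarrow>
       velocity_drop \<gamma> x y \<le> kappa \<gamma> * (y - x) + C * \<bar>y - x\<bar> ^ 3 / x\<^sup>2"
proof -
  obtain C where C: "C > 0"
    "\<And>z. 1 < z \<Longrightarrow> z \<le> 2 \<Longrightarrow> shock_slope \<gamma> z \<le> kappa \<gamma> + C * (z - 1)\<^sup>2"
    using shock_slope_upper[OF g] by blast
  show ?thesis
  proof (rule that[OF C(1)])
    fix x y :: real assume x: "0 < x" and y: "y \<le> 2 * x"
    show "velocity_drop \<gamma> x y \<le> kappa \<gamma> * (y - x) + C * \<bar>y - x\<bar> ^ 3 / x\<^sup>2"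
    proof (cases "x < y")
      case True
      have "velocity_drop \<gamma> x y = (y - x) * shock_slope \<gamma> (y / x)"
        using velocity_drop_shock[OF g x True] .
      also have "\<dots> \<le> (y - x) * (kappa \<gamma> + C * (y / x - 1)\<^sup>2)"
        using True x y by (intro mult_left_mono C(2)) (auto simp: field_simps)
      also have "(y / x - 1)\<^sup>2 = (y - x)\<^sup>2 / x\<^sup>2" using x by (simp add: diff_divide_distrib flip: power_divide)
      finally show ?thesis using True by (simp add: algebra_simps power2_eq_square power3_eq_cube)
    next
      case False
      then show ?thesis using x C(1) by (simp add: velocity_drop_rarefaction)
    qed
  qed
qed

lemma wave_state_backward:
  "\<xi> > 0 \<Longrightarrow> wave_state \<gamma> Backward (y / \<xi>) (\<xi>, u) = (y, u - velocity_drop \<gamma> \<xi> y)"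
  by (simp add: velocity_drop_def)

lemma wave_state_forward:
  assumes g: "\<gamma> > 1" and x: "\<xi> > 0" "y > 0"
  shows "wave_state \<gamma> Forward (y / \<xi>) (\<xi>, u) = (y, u - velocity_drop \<gamma> y \<xi>)"
proof (cases "y < \<xi>")
  case False
  then show ?thesis using x
    by (auto simp: Phi_plus_def velocity_drop_rarefaction field_simps)
next
  case True
  define f h where "f = y / \<xi>" and "h = 1 / alpha \<gamma>"
  have f: "0 < f" "f < 1" using x True by (auto simp: f_def)
  have a: "- 1 / alpha \<gamma> = - h" "\<gamma> / alpha \<gamma> = 2 + h"
    using gamma_over_alpha[OF g] by (simp_all add: h_def)
  have fm: "\<xi> / y = 1 / f" by (simp add: f_def)
  have p: "(1 / f) powr t = 1 / f powr t" for t using f by (simp add: powr_divide)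
  have p2: "f powr (2 + h) = f\<^sup>2 * f powr h" using f by (simp add: powr_add)
  have pp: "f powr h > 0" using f by simp
  have "Phi_minus \<gamma> (1 / f)
      = sqrt ((1 - (1 / f) powr (- h)) * ((1 / f) powr (2 + h) - 1))"
    using f unfolding Phi_minus_def a by simp
  also have "(1 - (1 / f) powr (- h)) * ((1 / f) powr (2 + h) - 1)
      = (1 - f powr (- h)) * (f powr (2 + h) - 1) / f\<^sup>2"
    using f pp unfolding p p2 powr_minus by (simp add: field_simps power2_eq_square)
  also have "sqrt \<dots> = - Phi_plus \<gamma> f / f"
    using f unfolding Phi_plus_def a by (simp add: real_sqrt_divide)
  finally have "y * Phi_minus \<gamma> (\<xi> / y) = - Phi_plus \<gamma> f * \<xi>"
    unfolding fm using x by (simp add: f_def)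
  then show ?thesis using x by (simp add: velocity_drop_def f_def)
qed

section \<open>Variation across waves and interactions\<close>

definition state_field :: "real \<Rightarrow> (real \<times> real \<Rightarrow> real) \<Rightarrow> state \<Rightarrow> real" where
  "state_field \<gamma> \<phi> U = \<phi> (riemann_coords \<gamma> U)"

text \<open>
  Outgoing waves are only ever bounded from below, and for this the jump is enough, whatever the
  type of the wave.
\<close>

lemma jump_le_wave_variation:
  assumes "x > 0"
  shows "ennreal \<bar>\<phi> (riemann_coords \<gamma> (wave_state \<gamma> k x U)) - \<phi> (riemann_coords \<gamma> U)\<bar>
    \<le> wave_variation \<gamma> \<phi> k x U"
proof (cases "is_shock k x")
  case True
  then show ?thesis by (simp add: wave_variation_def)
next
  case False
  define \<psi> where "\<psi> = (\<lambda>y. \<phi> (riemann_coords \<gamma> (wave_state \<gamma> k y U)))"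
  have one: "wave_state \<gamma> k 1 U = U"
    by (cases k; cases U) (auto simp: Phi_minus_def Phi_plus_def)
  define t :: "nat \<Rightarrow> real" where "t = (\<lambda>i. if i = 0 then min 1 x else max 1 x)"
  have "(1 :: nat, t) \<in> {(n, t). mono_on {..n} t \<and> t ` {..n} \<subseteq> closed_segment 1 x}"
    by (auto simp: t_def mono_on_def closed_segment_eq_real_ivl)
  then have "(\<Sum>i<1::nat. ennreal \<bar>\<psi> (t (Suc i)) - \<psi> (t i)\<bar>)
      \<le> total_variation_on \<psi> (closed_segment 1 x)"
    unfolding total_variation_on_def by (rule SUP_upper2) simp
  moreover have "\<bar>\<psi> (t 1) - \<psi> (t 0)\<bar> = \<bar>\<psi> x - \<psi> 1\<bar>"
    by (auto simp: t_def min_def max_def)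
  ultimately show ?thesis
    using False by (simp add: wave_variation_def one \<psi>_def)
qed

text \<open>
  The factor \<open>c = \<plusminus>1\<close> treats increasing and decreasing fields at once.
\<close>

lemma total_variation_on_monotone:
  assumes "a \<le> b" and c: "\<bar>c\<bar> = 1"
    and mono: "\<And>x y. a \<le> x \<Longrightarrow> x \<le> y \<Longrightarrow> y \<le> b \<Longrightarrow> c * g x \<le> c * g y"
  shows "total_variation_on g {a..b} \<le> ennreal \<bar>g b - g a\<bar>"
  unfolding total_variation_on_def
proof (rule SUP_least, clarify)
  fix n :: nat and t assume t: "mono_on {..n} t" "t ` {..n} \<subseteq> {a..b}"
  have in_ab: "a \<le> t i" "t i \<le> b" if "i \<le> n" for i using t(2) that by auto
  have *: "\<bar>g y - g x\<bar> = c * g y - c * g x" if "a \<le> x" "x \<le> y" "y \<le> b" for x y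
    using mono[OF that] c by (auto simp: abs_if split: if_splits)
  have "(\<Sum>i<n. \<bar>g (t (Suc i)) - g (t i)\<bar>) = (\<Sum>i<n. c * g (t (Suc i)) - c * g (t i))"
    by (rule sum.cong[OF refl], rule *)
       (use t(1) in_ab in \<open>auto simp: mono_on_def\<close>)
  also have "\<dots> = c * g (t n) - c * g (t 0)" by (rule sum_lessThan_telescope)
  also have "\<dots> \<le> c * g b - c * g a"
    using mono[of "t n" b] mono[of a "t 0"] in_ab[of n] in_ab[of 0] by simp
  also have "\<dots> = \<bar>g b - g a\<bar>" using *[of a b] assms(1) by simp
  finally show "(\<Sum>i<n. ennreal \<bar>g (t (Suc i)) - g (t i)\<bar>) \<le> ennreal \<bar>g b - g a\<bar>"
    by (simp add: ennreal_leI)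
qed

lemma glimm_TVD_jumps:
  assumes tvd: "glimm_TVD \<gamma> \<phi>" and "fst Ul > 0"
    and "x > 0" "x \<noteq> 1" "x' > 0" "x' \<noteq> 1" "approaching k x k' x'"
    and Um: "wave_state \<gamma> k x Ul = Um" and Ur: "wave_state \<gamma> k' x' Um = Ur"
    and "b > 0" "f > 0"
    and Um': "wave_state \<gamma> Backward b Ul = Um'" and Ur': "wave_state \<gamma> Forward f Um' = Ur"
    and J: "wave_variation \<gamma> \<phi> k x Ul \<le> ennreal J" "wave_variation \<gamma> \<phi> k' x' Um \<le> ennreal J'"
      "0 \<le> J" "0 \<le> J'"
  shows "\<bar>state_field \<gamma> \<phi> Um' - state_field \<gamma> \<phi> Ul\<bar>
    + \<bar>state_field \<gamma> \<phi> Ur - state_field \<gamma> \<phi> Um'\<bar> \<le> J + J'"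
proof -
  define F where "F = state_field \<gamma> \<phi>"
  have "ennreal \<bar>F Um' - F Ul\<bar> + ennreal \<bar>F Ur - F Um'\<bar>
      \<le> wave_variation \<gamma> \<phi> Backward b Ul + wave_variation \<gamma> \<phi> Forward f Um'"
    using jump_le_wave_variation[OF \<open>b > 0\<close>, of \<phi> \<gamma> Backward Ul]
      jump_le_wave_variation[OF \<open>f > 0\<close>, of \<phi> \<gamma> Forward Um']
    unfolding F_def state_field_def Um' Ur' by (rule add_mono)
  also have "\<dots> \<le> wave_variation \<gamma> \<phi> k x Ul + wave_variation \<gamma> \<phi> k' x' Um"
    using tvd assms(2-7) Um Ur Um' Ur' \<open>b > 0\<close> \<open>f > 0\<close>
    unfolding glimm_TVD_def riemann_solution_def by blast
  also have "\<dots> \<le> ennreal J + ennreal J'" using J by (intro add_mono)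
  finally have "ennreal (\<bar>F Um' - F Ul\<bar> + \<bar>F Ur - F Um'\<bar>) \<le> ennreal (J + J')"
    using J by simp
  then show ?thesis using J by (simp add: F_def del: ennreal_plus)
qed

lemma wave_variation_shock:
  "is_shock k x \<Longrightarrow> wave_variation \<gamma> \<phi> k x U
    = ennreal \<bar>state_field \<gamma> \<phi> (wave_state \<gamma> k x U) - state_field \<gamma> \<phi> U\<bar>"
  by (simp add: wave_variation_def state_field_def)

lemma wave_variation_forward_rarefaction:
  assumes g: "\<gamma> > 1" and x: "1 \<le> x" and \<xi>: "\<xi> > 0" and c: "\<bar>c\<bar> = 1"
    and rs: "riemann_coords \<gamma> (\<xi>, u) = (r, s)"
    and mono: "\<And>y z. s \<le> y \<Longrightarrow> y \<le> z \<Longrightarrow> z \<le> s + 2 * kappa \<gamma> * (x - 1) * \<xi> \<Longrightarrow>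
      c * \<phi> (r, y) \<le> c * \<phi> (r, z)"
  shows "wave_variation \<gamma> \<phi> Forward x (\<xi>, u)
    \<le> ennreal \<bar>state_field \<gamma> \<phi> (wave_state \<gamma> Forward x (\<xi>, u)) - state_field \<gamma> \<phi> (\<xi>, u)\<bar>"
proof -
  define \<psi> where "\<psi> = (\<lambda>y. \<phi> (riemann_coords \<gamma> (wave_state \<gamma> Forward y (\<xi>, u))))"
  have k: "kappa \<gamma> > 0" by (rule kappa_pos[OF g])
  have \<psi>: "\<psi> y = \<phi> (r, s + 2 * kappa \<gamma> * (y - 1) * \<xi>)" if "1 \<le> y" for y
    using that rs by (auto simp: \<psi>_def Phi_plus_def riemann_coords_def algebra_simps)
  have "total_variation_on \<psi> {1..x} \<le> ennreal \<bar>\<psi> x - \<psi> 1\<bar>"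
  proof (rule total_variation_on_monotone[OF x c])
    fix y z assume yz: "1 \<le> y" "y \<le> z" "z \<le> x"
    have "c * \<phi> (r, s + 2 * kappa \<gamma> * (y - 1) * \<xi>) \<le> c * \<phi> (r, s + 2 * kappa \<gamma> * (z - 1) * \<xi>)"
      using yz k \<xi> by (intro mono add_left_mono mult_right_mono mult_left_mono) auto
    then show "c * \<psi> y \<le> c * \<psi> z" using yz by (simp add: \<psi>)
  qed
  moreover have "\<psi> 1 = \<phi> (riemann_coords \<gamma> (\<xi>, u))" by (simp add: \<psi>_def Phi_plus_def)
  moreover have "closed_segment 1 x = {1..x}" "\<not> is_shock Forward x"
    using x by (auto simp: closed_segment_eq_real_ivl)
  ultimately show ?thesis
    by (simp add: wave_variation_def state_field_def \<psi>_def del: wave_state.simps is_shock.simps)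
qed

lemma wave_variation_backward_rarefaction:
  assumes g: "\<gamma> > 1" and x: "x \<le> 1" and \<xi>: "\<xi> > 0" and c: "\<bar>c\<bar> = 1"
    and rs: "riemann_coords \<gamma> (\<xi>, u) = (r, s)"
    and mono: "\<And>y z. r \<le> y \<Longrightarrow> y \<le> z \<Longrightarrow> z \<le> r + 2 * kappa \<gamma> * (1 - x) * \<xi> \<Longrightarrow>
      c * \<phi> (y, s) \<le> c * \<phi> (z, s)"
  shows "wave_variation \<gamma> \<phi> Backward x (\<xi>, u)
    \<le> ennreal \<bar>state_field \<gamma> \<phi> (wave_state \<gamma> Backward x (\<xi>, u)) - state_field \<gamma> \<phi> (\<xi>, u)\<bar>"
proof -
  define \<psi> where "\<psi> = (\<lambda>y. \<phi> (riemann_coords \<gamma> (wave_state \<gamma> Backward y (\<xi>, u))))"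
  have k: "kappa \<gamma> > 0" by (rule kappa_pos[OF g])
  have \<psi>: "\<psi> y = \<phi> (r + 2 * kappa \<gamma> * (1 - y) * \<xi>, s)" if "y \<le> 1" for y
    using that rs by (auto simp: \<psi>_def Phi_minus_def riemann_coords_def algebra_simps)
  have "total_variation_on \<psi> {x..1} \<le> ennreal \<bar>\<psi> 1 - \<psi> x\<bar>"
  proof (rule total_variation_on_monotone[OF x, where c = "- c"])
    fix y z assume yz: "x \<le> y" "y \<le> z" "z \<le> 1"
    have "c * \<phi> (r + 2 * kappa \<gamma> * (1 - z) * \<xi>, s) \<le> c * \<phi> (r + 2 * kappa \<gamma> * (1 - y) * \<xi>, s)"
      using yz k \<xi> by (intro mono add_left_mono mult_right_mono mult_left_mono) auto
    then show "- c * \<psi> y \<le> - c * \<psi> z" using yz by (simp add: \<psi>)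
  qed (use c in simp)
  moreover have "\<psi> 1 = \<phi> (riemann_coords \<gamma> (\<xi>, u))" by (simp add: \<psi>_def Phi_minus_def)
  moreover have "closed_segment 1 x = {x..1}" "\<not> is_shock Backward x"
    using x by (auto simp: closed_segment_eq_real_ivl)
  ultimately show ?thesis
    by (simp add: wave_variation_def state_field_def \<psi>_def abs_minus_commute
        del: wave_state.simps is_shock.simps)
qed

text \<open>
  In terms of the velocity drop, the interaction is resolved exactly when the drops across the two
  incoming waves, which both have \<open>\<xi>\<^sub>m\<close> in front, add up to the drops across the outgoing
  waves, which both have \<open>\<xi>\<^sub>m'\<close> behind.
\<close>

lemma glimm_TVD_head_on:
  assumes g: "\<gamma> > 1" and tvd: "glimm_TVD \<gamma> \<phi>"
    and pos: "xl > 0" "xm > 0" "xr > 0" "xm' > 0" and ne: "xm \<noteq> xl" "xr \<noteq> xm"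
    and balance: "velocity_drop \<gamma> xm xl + velocity_drop \<gamma> xm xr
      = velocity_drop \<gamma> xl xm' + velocity_drop \<gamma> xr xm'"
    and Um: "Um = (xm, u - velocity_drop \<gamma> xm xl)"
    and Ur: "Ur = (xr, u - velocity_drop \<gamma> xm xl - velocity_drop \<gamma> xm xr)"
    and Um': "Um' = (xm', u - velocity_drop \<gamma> xl xm')"
    and J: "wave_variation \<gamma> \<phi> Forward (xm / xl) (xl, u) \<le> ennreal J"
      "wave_variation \<gamma> \<phi> Backward (xr / xm) Um \<le> ennreal J'" "0 \<le> J" "0 \<le> J'"
  shows "\<bar>state_field \<gamma> \<phi> Um' - state_field \<gamma> \<phi> (xl, u)\<bar>
    + \<bar>state_field \<gamma> \<phi> Ur - state_field \<gamma> \<phi> Um'\<bar> \<le> J + J'"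
proof (rule glimm_TVD_jumps[OF tvd])
  show "wave_state \<gamma> Forward (xm / xl) (xl, u) = Um"
    using pos by (simp only: wave_state_forward[OF g] Um)
  show "wave_state \<gamma> Backward (xr / xm) Um = Ur"
    using pos by (simp only: wave_state_backward Um Ur)
  show "wave_state \<gamma> Backward (xm' / xl) (xl, u) = Um'"
    using pos by (simp only: wave_state_backward Um')
  show "wave_state \<gamma> Forward (xr / xm') Um' = Ur"
    using pos balance by (simp only: wave_state_forward[OF g] Um' Ur) simp
  show "0 < xm / xl" "xm / xl \<noteq> 1" "0 < xr / xm" "xr / xm \<noteq> 1" "0 < xm' / xl" "0 < xr / xm'"
    using pos ne by auto
qed (use pos J in \<open>auto simp: approaching_def\<close>)

section \<open>Weak head-on interactions\<close>

text \<open>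
  Without the shock corrections all waves are straight, and the middle state after the interaction
  completes a parallelogram: \<open>\<xi>\<^sub>m' = \<xi>\<^sub>l + \<xi>\<^sub>r - \<xi>\<^sub>m\<close>. The corrections are cubic, and the total
  outgoing velocity drop increases in \<open>\<xi>\<^sub>m'\<close> at rate at least \<open>2 \<kappa>\<close>. The intermediate value
  theorem therefore finds the true middle state within a cubic distance of the parallelogram.
  Signs are left free, so that each incoming wave may be a shock or a rarefaction.
\<close>

lemma weak_head_on_interaction:
  assumes g: "\<gamma> > 1" and x0: "x0 > 0"
  obtains C \<delta> where "C > 0" "\<delta> > 0"
    "\<And>\<epsilon> xm xr. 0 < \<epsilon> \<Longrightarrow> \<epsilon> < \<delta> \<Longrightarrow> \<bar>xm - x0\<bar> = \<epsilon> \<Longrightarrow> \<bar>xr - xm\<bar> = \<epsilon> \<Longrightarrow>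
      0 < xm \<and> 0 < xr \<and>
      (\<exists>xm' > 0. \<bar>xm' - (x0 + xr - xm)\<bar> \<le> C * \<epsilon> ^ 3 \<and>
        velocity_drop \<gamma> xm x0 + velocity_drop \<gamma> xm xr
          = velocity_drop \<gamma> x0 xm' + velocity_drop \<gamma> xr xm' \<and>
        velocity_drop \<gamma> xm x0 \<le> kappa \<gamma> * (x0 - xm) + C * \<epsilon> ^ 3 \<and>
        velocity_drop \<gamma> xm xr \<le> kappa \<gamma> * (xr - xm) + C * \<epsilon> ^ 3 \<and>
        velocity_drop \<gamma> x0 xm' \<le> kappa \<gamma> * (xm' - x0) + C * \<epsilon> ^ 3)"
proof -
  define \<kappa> where "\<kappa> = kappa \<gamma>"
  have \<kappa>: "\<kappa> > 0" using kappa_pos[OF g] by (simp add: \<kappa>_def)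
  obtain C0 where C0: "C0 > 0" "\<And>x y. 0 < x \<Longrightarrow> y \<le> 2 * x \<Longrightarrow>
       velocity_drop \<gamma> x y \<le> \<kappa> * (y - x) + C0 * \<bar>y - x\<bar> ^ 3 / x\<^sup>2"
    using velocity_drop_upper[OF g] unfolding \<kappa>_def by blast
  define C1 where "C1 = 32 * C0 / x0\<^sup>2"
  have C1: "C1 > 0" using C0 x0 by (simp add: C1_def)
  define C where "C = C1 + C1 / \<kappa>"
  \<comment> \<open>The bounds on \<open>\<epsilon>\<close> keep all states within a factor of two and ensure \<open>\<theta> \<le> \<epsilon>\<close> below.\<close>
  define \<delta> where "\<delta> = min (x0 / 8) (min 1 (\<kappa> / C1))"
  have low: "\<kappa> * (y - x) \<le> velocity_drop \<gamma> x y" if "x > 0" for x y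
    using velocity_drop_ge_kappa[OF g that] by (simp add: \<kappa>_def)
  show ?thesis
  proof (rule that[of C \<delta>])
    show "C > 0" "\<delta> > 0" using C1 \<kappa> x0 by (auto simp: C_def \<delta>_def add_pos_pos)
    fix \<epsilon> xm xr assume \<epsilon>: "0 < \<epsilon>" "\<epsilon> < \<delta>" and xm: "\<bar>xm - x0\<bar> = \<epsilon>" and xr: "\<bar>xr - xm\<bar> = \<epsilon>"
    define T where "T = velocity_drop \<gamma> xm x0 + velocity_drop \<gamma> xm xr"
    define V where "V = (\<lambda>y. velocity_drop \<gamma> x0 y + velocity_drop \<gamma> xr y)"
    define y0 where "y0 = x0 + xr - xm"
    define \<eta> where "\<eta> = C1 * \<epsilon> ^ 3"
    define \<theta> where "\<theta> = \<eta> / \<kappa>"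
    have \<epsilon>': "8 * \<epsilon> < x0" "\<epsilon> < 1" "C1 * \<epsilon> < \<kappa>"
      using \<epsilon> C1 by (auto simp: \<delta>_def field_simps)
    have pos: "xm > 0" "xr > 0" "xm \<ge> x0 / 2" "xr \<ge> x0 / 2"
      using \<epsilon>' \<epsilon> xm xr by linarith+
    have \<eta>: "\<eta> > 0" using C1 \<epsilon> by (simp add: \<eta>_def)
    have "C1 * \<epsilon> * (\<epsilon> * \<epsilon>) \<le> \<kappa> * (1 * \<epsilon>)"
      using \<epsilon> \<epsilon>' C1 \<kappa> by (intro mult_mono) auto
    then have \<theta>: "0 < \<theta>" "\<theta> \<le> \<epsilon>"
      using \<eta> \<kappa> by (auto simp: \<theta>_def \<eta>_def field_simps power3_eq_cube)
    have \<kappa>\<theta>: "\<kappa> * \<theta> = \<eta>" using \<kappa> by (simp add: \<theta>_def)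
    have up: "velocity_drop \<gamma> x y \<le> \<kappa> * (y - x) + \<eta>"
      if "x0 / 2 \<le> x" "\<bar>y - x\<bar> \<le> 2 * \<epsilon>" for x y
    proof -
      have "x > 0" "y \<le> 2 * x" using that x0 \<epsilon>' by linarith+
      then have "velocity_drop \<gamma> x y \<le> \<kappa> * (y - x) + C0 * \<bar>y - x\<bar> ^ 3 / x\<^sup>2" by (rule C0)
      also have "C0 * \<bar>y - x\<bar> ^ 3 / x\<^sup>2 \<le> C0 * (2 * \<epsilon>) ^ 3 / (x0 / 2)\<^sup>2"
        using that x0 C0 \<epsilon> by (intro frac_le mult_left_mono power_mono mult_nonneg_nonneg) auto
      also have "\<dots> = \<eta>" by (simp add: \<eta>_def C1_def power_divide power_mult_distrib)
      finally show ?thesis by simp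
    qed
    have up': "velocity_drop \<gamma> xm x0 \<le> \<kappa> * (x0 - xm) + \<eta>"
      "velocity_drop \<gamma> xm xr \<le> \<kappa> * (xr - xm) + \<eta>"
      using xm xr pos \<epsilon> by (auto intro!: up simp: abs_minus_commute[of x0])
    have T: "\<kappa> * (x0 + xr - 2 * xm) \<le> T" "T \<le> \<kappa> * (x0 + xr - 2 * xm) + 2 * \<eta>"
      using low[OF pos(1), of x0] low[OF pos(1), of xr] up'
      by (auto simp: T_def algebra_simps)
    have "T \<le> \<kappa> * (y0 + \<theta> - x0) + \<kappa> * (y0 + \<theta> - xr)"
      using T(2) \<kappa>\<theta> by (simp add: y0_def algebra_simps)
    also have "\<dots> \<le> V (y0 + \<theta>)"
      using low[OF x0, of "y0 + \<theta>"] low[OF pos(2), of "y0 + \<theta>"] by (simp add: V_def)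
    finally have hi: "T \<le> V (y0 + \<theta>)" .
    have near: "\<bar>y0 - \<theta> - x0\<bar> \<le> 2 * \<epsilon>" "\<bar>y0 - \<theta> - xr\<bar> \<le> 2 * \<epsilon>" "y0 - \<theta> > 0"
      using xm xr \<theta> \<epsilon>' by (auto simp: y0_def)
    have "V (y0 - \<theta>) \<le> \<kappa> * (y0 - \<theta> - x0) + \<eta> + (\<kappa> * (y0 - \<theta> - xr) + \<eta>)"
      unfolding V_def using near x0 pos by (intro add_mono up) auto
    also have "\<dots> \<le> T" using T(1) \<kappa>\<theta> by (simp add: y0_def algebra_simps)
    finally have lo: "V (y0 - \<theta>) \<le> T" .
    have "continuous_on {y0 - \<theta>..y0 + \<theta>} V"
      unfolding V_def
      by (intro continuous_intros continuous_on_subset[OF continuous_on_velocity_drop[OF x0]]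
          continuous_on_subset[OF continuous_on_velocity_drop[OF pos(2)]]) (use near in auto)
    then obtain xm' where xm': "y0 - \<theta> \<le> xm'" "xm' \<le> y0 + \<theta>" "V xm' = T"
      using IVT'[of V "y0 - \<theta>" T "y0 + \<theta>"] lo hi \<theta> by auto
    have le: "\<eta> \<le> C * \<epsilon> ^ 3" "\<theta> \<le> C * \<epsilon> ^ 3"
      using C1 \<kappa> \<epsilon> by (auto simp: C_def \<eta>_def \<theta>_def field_simps)
    have "velocity_drop \<gamma> x0 xm' \<le> \<kappa> * (xm' - x0) + \<eta>"
      using xm' \<theta> xm xr x0 by (intro up) (auto simp: y0_def)
    then show "0 < xm \<and> 0 < xr \<and>
      (\<exists>xm' > 0. \<bar>xm' - (x0 + xr - xm)\<bar> \<le> C * \<epsilon> ^ 3 \<and>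
        velocity_drop \<gamma> xm x0 + velocity_drop \<gamma> xm xr
          = velocity_drop \<gamma> x0 xm' + velocity_drop \<gamma> xr xm' \<and>
        velocity_drop \<gamma> xm x0 \<le> kappa \<gamma> * (x0 - xm) + C * \<epsilon> ^ 3 \<and>
        velocity_drop \<gamma> xm xr \<le> kappa \<gamma> * (xr - xm) + C * \<epsilon> ^ 3 \<and>
        velocity_drop \<gamma> x0 xm' \<le> kappa \<gamma> * (xm' - x0) + C * \<epsilon> ^ 3)"
      using pos xm' le up' near
      by (intro conjI exI[of _ xm']) (auto simp: V_def T_def y0_def \<kappa>_def)
  qed
qed

section \<open>Smooth fields on small squares\<close>

lemma open_no_vacuum: "open no_vacuum"
proof -
  have eq: "no_vacuum = {p. fst p < snd p}" by (auto simp: no_vacuum_def)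
  show ?thesis unfolding eq by (intro open_Collect_less continuous_intros)
qed

lemma C1_on_derivatives:
  assumes "C1_on S \<phi>" "(r, s) \<in> S"
  shows "((\<lambda>y. \<phi> (y, s)) has_real_derivative partial_r \<phi> (r, s)) (at r)"
    "((\<lambda>y. \<phi> (r, y)) has_real_derivative partial_s \<phi> (r, s)) (at s)"
  using assms by (auto simp: C1_on_def partial_r_def partial_s_def DERIV_deriv_iff_field_differentiable)

text \<open>
  Squares instead of discs, because they contain the rectangle spanned by any two of their points.
\<close>

definition square :: "real \<Rightarrow> real \<times> real \<Rightarrow> (real \<times> real) set" where
  "square d p = {fst p - d..fst p + d} \<times> {snd p - d..snd p + d}"

lemma square_mono: "d \<le> e \<Longrightarrow> square d p \<subseteq> square e p"
  by (auto simp: square_def)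

lemma square_segments:
  assumes "(r, s) \<in> square d p" "(r', s') \<in> square d p"
  shows "closed_segment r r' \<times> closed_segment s s' \<subseteq> square d p"
  using assms unfolding square_def
  by (auto simp: closed_segment_eq_real_ivl split: if_splits)

lemma eventually_square:
  assumes "open S" "p \<in> S"
  shows "\<forall>\<^sub>F d in at_right 0. square d p \<subseteq> S"
proof -
  obtain A B where AB: "open A" "open B" "p \<in> A \<times> B" "A \<times> B \<subseteq> S"
    using assms by (rule open_prod_elim)
  obtain a where a: "a > 0" "ball (fst p) a \<subseteq> A"
    using AB by (metis openE mem_Times_iff)
  obtain b where b: "b > 0" "ball (snd p) b \<subseteq> B"
    using AB by (metis openE mem_Times_iff)
  have "\<forall>\<^sub>F d in at_right 0. d \<in> {0<..<min a b}"
    using a b by (intro eventually_at_right_real) auto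
  then show ?thesis
  proof eventually_elim
    case (elim d)
    have "square d p \<subseteq> ball (fst p) a \<times> ball (snd p) b"
      using elim by (auto simp: square_def dist_real_def)
    then show ?case using a b AB by blast
  qed
qed

lemma eventually_square_sgn:
  fixes f :: "real \<times> real \<Rightarrow> real"
  assumes "open S" "p \<in> S" "continuous_on S f" "f p \<noteq> 0"
  shows "\<forall>\<^sub>F d in at_right 0. \<forall>q \<in> square d p. \<bar>f p\<bar> / 2 < sgn (f p) * f q"
proof -
  define W where "W = {q \<in> S. sgn (f p) * f q \<in> {\<bar>f p\<bar> / 2<..}}"
  have "open W"
    unfolding W_def using assms
    by (intro continuous_open_preimage[unfolded vimage_def Int_def, simplified] continuous_intros) auto
  moreover have "p \<in> W" using assms by (auto simp: W_def sgn_mult_self_eq abs_sgn[symmetric] mult.commute)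
  ultimately have "\<forall>\<^sub>F d in at_right 0. square d p \<subseteq> W" by (rule eventually_square)
  then show ?thesis by eventually_elim (auto simp: W_def)
qed

lemma mean_value_segment:
  fixes f :: "real \<Rightarrow> real"
  assumes "\<And>x. x \<in> closed_segment a b \<Longrightarrow> (f has_real_derivative f' x) (at x)"
  shows "\<exists>z \<in> closed_segment a b. f b - f a = (b - a) * f' z"
proof (cases a b rule: linorder_cases)
  case less
  then show ?thesis using MVT2[OF less, of f f'] assms
    by (force simp: closed_segment_eq_real_ivl)
next
  case equal
  then show ?thesis by auto
next
  case greater
  then obtain z where "b < z" "z < a" "f a - f b = (a - b) * f' z"
    using MVT2[OF greater, of f f'] assms by (auto simp: closed_segment_eq_real_ivl)
  then show ?thesis
    by (intro bexI[of _ z]) (auto simp: closed_segment_eq_real_ivl algebra_simps)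
qed

lemma mixed_difference_mean_value:
  assumes C1: "C1_on S \<phi>" "C1_on S (partial_r \<phi>)"
    and S: "closed_segment r r' \<times> closed_segment s s' \<subseteq> S"
  shows "\<exists>q \<in> closed_segment r r' \<times> closed_segment s s'.
    \<phi> (r, s) + \<phi> (r', s') - \<phi> (r, s') - \<phi> (r', s)
      = (r' - r) * (s' - s) * partial_s (partial_r \<phi>) q"
proof -
  have "((\<lambda>x. \<phi> (x, s') - \<phi> (x, s)) has_real_derivative
      partial_r \<phi> (x, s') - partial_r \<phi> (x, s)) (at x)" if "x \<in> closed_segment r r'" for x
    by (intro DERIV_diff C1_on_derivatives[OF C1(1)]) (use that S in auto)
  from mean_value_segment[OF this]
  obtain x where x: "x \<in> closed_segment r r'"
    "(\<phi> (r', s') - \<phi> (r', s)) - (\<phi> (r, s') - \<phi> (r, s))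
      = (r' - r) * (partial_r \<phi> (x, s') - partial_r \<phi> (x, s))"
    by blast
  have "((\<lambda>y. partial_r \<phi> (x, y)) has_real_derivative partial_s (partial_r \<phi>) (x, y)) (at y)"
    if "y \<in> closed_segment s s'" for y
    by (rule C1_on_derivatives[OF C1(2)]) (use that x S in auto)
  from mean_value_segment[OF this]
  obtain y where y: "y \<in> closed_segment s s'"
    "partial_r \<phi> (x, s') - partial_r \<phi> (x, s) = (s' - s) * partial_s (partial_r \<phi>) (x, y)"
    by blast
  show ?thesis using x y by (intro bexI[of _ "(x, y)"]) (auto simp: algebra_simps)
qed

lemma C1_on_square_Lipschitz:
  assumes C1: "C1_on S \<phi>" and S: "square d p \<subseteq> S"
  obtains L where "L > 0"
    "\<And>r s r' s'. (r, s) \<in> square d p \<Longrightarrow> (r', s') \<in> square d p \<Longrightarrow>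
      \<bar>\<phi> (r', s') - \<phi> (r, s)\<bar> \<le> L * (\<bar>r' - r\<bar> + \<bar>s' - s\<bar>)"
proof -
  have compact: "compact (square d p)" unfolding square_def by (intro compact_Times compact_Icc)
  have bd: "bounded (partial_r \<phi> ` square d p)" "bounded (partial_s \<phi> ` square d p)"
    using C1 S unfolding C1_on_def
    by (meson compact compact_continuous_image compact_imp_bounded continuous_on_subset)+
  obtain L1 where L1: "\<And>q. q \<in> square d p \<Longrightarrow> \<bar>partial_r \<phi> q\<bar> \<le> L1"
    using bd(1) by (auto simp: bounded_iff)
  obtain L2 where L2: "\<And>q. q \<in> square d p \<Longrightarrow> \<bar>partial_s \<phi> q\<bar> \<le> L2"
    using bd(2) by (auto simp: bounded_iff)
  define L where "L = max 1 (max L1 L2)"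
  have "\<bar>\<phi> (r', s') - \<phi> (r, s)\<bar> \<le> L * (\<bar>r' - r\<bar> + \<bar>s' - s\<bar>)"
    if "(r, s) \<in> square d p" "(r', s') \<in> square d p" for r s r' s'
  proof -
    note seg = square_segments[OF that]
    have "((\<lambda>x. \<phi> (x, s')) has_real_derivative partial_r \<phi> (x, s')) (at x)"
      if "x \<in> closed_segment r r'" for x
      by (rule C1_on_derivatives[OF C1]) (use that S seg in auto)
    from mean_value_segment[OF this]
    obtain x where x: "x \<in> closed_segment r r'"
      "\<phi> (r', s') - \<phi> (r, s') = (r' - r) * partial_r \<phi> (x, s')"
      by blast
    have "((\<lambda>y. \<phi> (r, y)) has_real_derivative partial_s \<phi> (r, y)) (at y)"
      if "y \<in> closed_segment s s'" for y
      by (rule C1_on_derivatives[OF C1]) (use that S seg in auto)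
    from mean_value_segment[OF this]
    obtain y where y: "y \<in> closed_segment s s'"
      "\<phi> (r, s') - \<phi> (r, s) = (s' - s) * partial_s \<phi> (r, y)"
      by blast
    have "\<bar>\<phi> (r', s') - \<phi> (r, s)\<bar> = \<bar>(r' - r) * partial_r \<phi> (x, s') + (s' - s) * partial_s \<phi> (r, y)\<bar>"
      using x y by simp
    also have "\<dots> \<le> \<bar>r' - r\<bar> * \<bar>partial_r \<phi> (x, s')\<bar> + \<bar>s' - s\<bar> * \<bar>partial_s \<phi> (r, y)\<bar>"
      by (metis abs_mult abs_triangle_ineq)
    also have "\<dots> \<le> \<bar>r' - r\<bar> * L + \<bar>s' - s\<bar> * L"
    proof (intro add_mono mult_left_mono)
      have "(x, s') \<in> square d p" "(r, y) \<in> square d p" using x y seg by auto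
      then show "\<bar>partial_r \<phi> (x, s')\<bar> \<le> L" "\<bar>partial_s \<phi> (r, y)\<bar> \<le> L"
        using L1[of "(x, s')"] L2[of "(r, y)"] unfolding L_def by linarith+
    qed auto
    finally show ?thesis by (simp add: algebra_simps)
  qed
  then show ?thesis by (intro that[of L]) (auto simp: L_def)
qed

lemma difference_sign_r:
  assumes C1: "C1_on S \<phi>" and S: "square d p \<subseteq> S"
    and sgn: "\<And>q. q \<in> square d p \<Longrightarrow> 0 \<le> c * partial_r \<phi> q"
    and yz: "(y, s) \<in> square d p" "(z, s) \<in> square d p"
  shows "0 \<le> c * (z - y) * (\<phi> (z, s) - \<phi> (y, s))"
proof -
  note seg = square_segments[OF yz]
  have "((\<lambda>x. \<phi> (x, s)) has_real_derivative partial_r \<phi> (x, s)) (at x)"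
    if "x \<in> closed_segment y z" for x
    by (rule C1_on_derivatives[OF C1]) (use that S seg in auto)
  from mean_value_segment[OF this] obtain x where x: "x \<in> closed_segment y z"
    "\<phi> (z, s) - \<phi> (y, s) = (z - y) * partial_r \<phi> (x, s)" by blast
  have "0 \<le> (z - y)\<^sup>2 * (c * partial_r \<phi> (x, s))"
    using x seg by (intro mult_nonneg_nonneg sgn) auto
  also have "\<dots> = c * (z - y) * (\<phi> (z, s) - \<phi> (y, s))"
    unfolding x(2) by (simp add: power2_eq_square)
  finally show ?thesis .
qed

lemma difference_sign_s:
  assumes C1: "C1_on S \<phi>" and S: "square d p \<subseteq> S"
    and sgn: "\<And>q. q \<in> square d p \<Longrightarrow> 0 \<le> c * partial_s \<phi> q"
    and yz: "(r, y) \<in> square d p" "(r, z) \<in> square d p"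
  shows "0 \<le> c * (z - y) * (\<phi> (r, z) - \<phi> (r, y))"
proof -
  note seg = square_segments[OF yz]
  have "((\<lambda>x. \<phi> (r, x)) has_real_derivative partial_s \<phi> (r, x)) (at x)"
    if "x \<in> closed_segment y z" for x
    by (rule C1_on_derivatives[OF C1]) (use that S seg in auto)
  from mean_value_segment[OF this] obtain x where x: "x \<in> closed_segment y z"
    "\<phi> (r, z) - \<phi> (r, y) = (z - y) * partial_s \<phi> (r, x)" by blast
  have "0 \<le> (z - y)\<^sup>2 * (c * partial_s \<phi> (r, x))"
    using x seg by (intro mult_nonneg_nonneg sgn) auto
  also have "\<dots> = c * (z - y) * (\<phi> (r, z) - \<phi> (r, y))"
    unfolding x(2) by (simp add: power2_eq_square)
  finally show ?thesis .
qed

section \<open>The mixed derivative of a TVD field\<close>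

lemma wave_variation_forward_le_jump:
  assumes g: "\<gamma> > 1" and C1: "C1_on S \<phi>" and S: "square d p \<subseteq> S" and c: "\<bar>c\<bar> = 1"
    and sgn: "\<And>q. q \<in> square d p \<Longrightarrow> 0 \<le> c * partial_s \<phi> q"
    and pos: "xl > 0" "xm > 0" "xm \<noteq> xl"
    and L: "riemann_coords \<gamma> (xl, u) \<in> square d p"
    and a: "fst (riemann_coords \<gamma> (xl, u)) = r" "(r, snd (riemann_coords \<gamma> (xl, u)) + 2 * kappa \<gamma> * (xm - xl)) \<in> square d p"
  shows "wave_variation \<gamma> \<phi> Forward (xm / xl) (xl, u)
    \<le> ennreal \<bar>state_field \<gamma> \<phi> (wave_state \<gamma> Forward (xm / xl) (xl, u)) - state_field \<gamma> \<phi> (xl, u)\<bar>"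
proof (cases "xm < xl")
  case True
  then show ?thesis using pos by (simp add: wave_variation_shock)
next
  case False
  define s where "s = snd (riemann_coords \<gamma> (xl, u))"
  have rs: "riemann_coords \<gamma> (xl, u) = (r, s)" using a by (metis s_def prod.collapse)
  have e: "2 * kappa \<gamma> * (xm / xl - 1) * xl = 2 * kappa \<gamma> * (xm - xl)"
    using pos by (simp add: field_simps)
  show ?thesis
  proof (rule wave_variation_forward_rarefaction[OF g _ pos(1) c rs])
    show "1 \<le> xm / xl" using False pos by simp
    fix y z assume yz: "s \<le> y" "y \<le> z" "z \<le> s + 2 * kappa \<gamma> * (xm / xl - 1) * xl"
    have "(r, y) \<in> square d p" "(r, z) \<in> square d p"
      using yz L a rs unfolding e by (auto simp: square_def)
    then have "0 \<le> c * (z - y) * (\<phi> (r, z) - \<phi> (r, y))"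
      by (intro difference_sign_s[OF C1 S sgn])
    then have "0 \<le> (z - y) * (c * \<phi> (r, z) - c * \<phi> (r, y))" by (simp add: algebra_simps)
    then show "c * \<phi> (r, y) \<le> c * \<phi> (r, z)"
      using yz by (cases "y = z") (auto simp: zero_le_mult_iff)
  qed
qed

lemma wave_variation_backward_le_jump:
  assumes g: "\<gamma> > 1" and C1: "C1_on S \<phi>" and S: "square d p \<subseteq> S" and c: "\<bar>c\<bar> = 1"
    and sgn: "\<And>q. q \<in> square d p \<Longrightarrow> 0 \<le> c * partial_r \<phi> q"
    and pos: "xm > 0" "xr > 0" "xr \<noteq> xm"
    and L: "riemann_coords \<gamma> (xm, u) \<in> square d p"
    and a: "snd (riemann_coords \<gamma> (xm, u)) = s"
      "(fst (riemann_coords \<gamma> (xm, u)) + 2 * kappa \<gamma> * (xm - xr), s) \<in> square d p"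
  shows "wave_variation \<gamma> \<phi> Backward (xr / xm) (xm, u)
    \<le> ennreal \<bar>state_field \<gamma> \<phi> (wave_state \<gamma> Backward (xr / xm) (xm, u)) - state_field \<gamma> \<phi> (xm, u)\<bar>"
proof (cases "xm < xr")
  case True
  then show ?thesis using pos by (simp add: wave_variation_shock)
next
  case False
  define r where "r = fst (riemann_coords \<gamma> (xm, u))"
  have rs: "riemann_coords \<gamma> (xm, u) = (r, s)" using a by (metis r_def prod.collapse)
  have e: "2 * kappa \<gamma> * (1 - xr / xm) * xm = 2 * kappa \<gamma> * (xm - xr)"
    using pos by (simp add: field_simps)
  show ?thesis
  proof (rule wave_variation_backward_rarefaction[OF g _ pos(1) c rs])
    show "xr / xm \<le> 1" using False pos by simp
    fix y z assume yz: "r \<le> y" "y \<le> z" "z \<le> r + 2 * kappa \<gamma> * (1 - xr / xm) * xm"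
    have "(y, s) \<in> square d p" "(z, s) \<in> square d p"
      using yz L a rs unfolding e by (auto simp: square_def)
    then have "0 \<le> c * (z - y) * (\<phi> (z, s) - \<phi> (y, s))"
      by (intro difference_sign_r[OF C1 S sgn])
    then have "0 \<le> (z - y) * (c * \<phi> (z, s) - c * \<phi> (y, s))" by (simp add: algebra_simps)
    then show "c * \<phi> (y, s) \<le> c * \<phi> (z, s)"
      using yz by (cases "y = z") (auto simp: zero_le_mult_iff)
  qed
qed

lemma abs_eq_signed:
  fixes c x a :: real
  assumes "0 \<le> c * (b * a) * x" "\<bar>c\<bar> = 1" "\<bar>b\<bar> = 1" "a > 0"
  shows "\<bar>x\<bar> = c * b * x"
proof -
  have "0 \<le> a * (c * b * x)" using assms(1) by (simp add: algebra_simps)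
  then have "0 \<le> c * b * x" using assms(4) by (simp add: zero_le_mult_iff)
  then show ?thesis using assms(2,3) by (metis abs_mult abs_of_nonneg mult_1)
qed

text \<open>
  Near \<open>p\<close> the field is strictly monotone in \<open>r\<close> and in \<open>s\<close>, so the variation across a
  rarefaction is the absolute value of its jump. Consider a weak head-on interaction in which the
  forward wave shifts \<open>s\<close> by \<open>\<sigma> a\<close> and the backward wave shifts \<open>r\<close> by \<open>\<rho> a\<close>, with signs
  \<open>\<sigma>, \<rho> = \<plusminus>1\<close> (plus for rarefactions, minus for shocks). Up to errors of order \<open>a\<^sup>3\<close> the four
  states are the corners of a square in the \<open>(r, s)\<close> plane, and the variations on opposite sides
  have the same signs. The difference of incoming and outgoing variation is therefore
  \<open>(\<sigma> sgn \<phi>\<^sub>r - \<rho> sgn \<phi>\<^sub>s) a\<^sup>2 \<phi>\<^sub>r\<^sub>s + O(a\<^sup>3)\<close>.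
  The signs \<open>\<sigma>\<close> and \<open>\<rho>\<close> can be chosen to make the coefficient \<open>2\<close> or \<open>- 2\<close>, so \<open>\<phi>\<^sub>r\<^sub>s\<close> can be
  neither negative nor positive.
\<close>

lemma mixed_partial_eq_0_if_gradient_nonzero:
  assumes g: "\<gamma> > 1" and C2: "C2_on no_vacuum \<phi>" and tvd: "glimm_TVD \<gamma> \<phi>"
    and p: "p \<in> no_vacuum" and nz: "partial_r \<phi> p \<noteq> 0" "partial_s \<phi> p \<noteq> 0"
  shows "partial_s (partial_r \<phi>) p = 0"
proof (rule ccontr)
  assume nz': "partial_s (partial_r \<phi>) p \<noteq> 0"
  define \<kappa> where "\<kappa> = kappa \<gamma>"
  have \<kappa>: "\<kappa> > 0" using kappa_pos[OF g] by (simp add: \<kappa>_def)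
  have C1: "C1_on no_vacuum \<phi>" "C1_on no_vacuum (partial_r \<phi>)"
    and cont: "continuous_on no_vacuum (partial_r \<phi>)" "continuous_on no_vacuum (partial_s \<phi>)"
      "continuous_on no_vacuum (partial_s (partial_r \<phi>))"
    using C2 by (auto simp: C2_on_def C1_on_def)
  define sr ss \<tau> where "sr = sgn (partial_r \<phi> p)" and "ss = sgn (partial_s \<phi> p)"
    and "\<tau> = sgn (partial_s (partial_r \<phi>) p)"
  define c0 where "c0 = \<bar>partial_s (partial_r \<phi>) p\<bar> / 2"
  have c0: "c0 > 0" using nz' by (simp add: c0_def)
  have unit: "\<bar>sr\<bar> = 1" "\<bar>ss\<bar> = 1" "\<bar>\<tau>\<bar> = 1"
    using nz nz' by (auto simp: sr_def ss_def \<tau>_def abs_sgn_eq)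
  have "\<forall>\<^sub>F d in at_right 0. d > 0 \<and> square d p \<subseteq> no_vacuum
      \<and> (\<forall>q \<in> square d p. \<bar>partial_r \<phi> p\<bar> / 2 < sr * partial_r \<phi> q)
      \<and> (\<forall>q \<in> square d p. \<bar>partial_s \<phi> p\<bar> / 2 < ss * partial_s \<phi> q)
      \<and> (\<forall>q \<in> square d p. c0 < \<tau> * partial_s (partial_r \<phi>) q)"
    unfolding sr_def ss_def \<tau>_def c0_def
    by (intro eventually_conj eventually_at_right_less eventually_square
        eventually_square_sgn[OF open_no_vacuum p] open_no_vacuum p cont nz nz')
  then obtain d where d: "d > 0" and sq: "square d p \<subseteq> no_vacuum"
    and sr: "\<And>q. q \<in> square d p \<Longrightarrow> \<bar>partial_r \<phi> p\<bar> / 2 < sr * partial_r \<phi> q"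
    and ss: "\<And>q. q \<in> square d p \<Longrightarrow> \<bar>partial_s \<phi> p\<bar> / 2 < ss * partial_s \<phi> q"
    and \<tau>: "\<And>q. q \<in> square d p \<Longrightarrow> c0 < \<tau> * partial_s (partial_r \<phi>) q"
    using eventually_happens'[OF trivial_limit_at_right_real] by blast
  have sr0: "0 \<le> sr * partial_r \<phi> q" and ss0: "0 \<le> ss * partial_s \<phi> q"
    if "q \<in> square d p" for q
    using sr[OF that] ss[OF that] by linarith+
  obtain L where L: "L > 0"
    "\<And>r s r' s'. (r, s) \<in> square d p \<Longrightarrow> (r', s') \<in> square d p \<Longrightarrow>
      \<bar>\<phi> (r', s') - \<phi> (r, s)\<bar> \<le> L * (\<bar>r' - r\<bar> + \<bar>s' - s\<bar>)"
    using C1_on_square_Lipschitz[OF C1(1) sq] by blast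
  obtain r0 s0 where p_eq: "p = (r0, s0)" by (cases p)
  define x0 u where "x0 = (s0 - r0) / (2 * \<kappa>)" and "u = (r0 + s0) / 2"
  have x0: "x0 > 0" using p \<kappa> by (simp add: x0_def p_eq no_vacuum_def)
  have \<kappa>x0: "\<kappa> * x0 = (s0 - r0) / 2" using \<kappa> by (simp add: x0_def)
  have coords: "riemann_coords \<gamma> (\<xi>, w) = (w - \<kappa> * \<xi>, w + \<kappa> * \<xi>)" for \<xi> w
    by (simp add: riemann_coords_def \<kappa>_def)
  have p_coords: "riemann_coords \<gamma> (x0, u) = (r0, s0)"
    unfolding coords \<kappa>x0 u_def by (simp add: field_simps)
  obtain C \<delta> where C: "C > 0" "\<delta> > 0"
    and weak: "\<And>\<epsilon> xm xr. 0 < \<epsilon> \<Longrightarrow> \<epsilon> < \<delta> \<Longrightarrow> \<bar>xm - x0\<bar> = \<epsilon> \<Longrightarrow> \<bar>xr - xm\<bar> = \<epsilon> \<Longrightarrow>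
      0 < xm \<and> 0 < xr \<and>
      (\<exists>xm' > 0. \<bar>xm' - (x0 + xr - xm)\<bar> \<le> C * \<epsilon> ^ 3 \<and>
        velocity_drop \<gamma> xm x0 + velocity_drop \<gamma> xm xr
          = velocity_drop \<gamma> x0 xm' + velocity_drop \<gamma> xr xm' \<and>
        velocity_drop \<gamma> xm x0 \<le> \<kappa> * (x0 - xm) + C * \<epsilon> ^ 3 \<and>
        velocity_drop \<gamma> xm xr \<le> \<kappa> * (xr - xm) + C * \<epsilon> ^ 3 \<and>
        velocity_drop \<gamma> x0 xm' \<le> \<kappa> * (xm' - x0) + C * \<epsilon> ^ 3)"
    using weak_head_on_interaction[OF g x0] unfolding \<kappa>_def by metis
  define K where "K = L * (16 + 4 * \<kappa>) * C"
  have "\<forall>\<^sub>F \<epsilon> in at_right 0. 0 < \<epsilon> \<and> \<epsilon> < \<delta> \<and> 2 * \<kappa> * \<epsilon> + (2 * \<kappa> + 4) * (C * \<epsilon> ^ 3) < d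
      \<and> K * \<epsilon> < 8 * \<kappa>\<^sup>2 * c0"
  proof (intro eventually_conj eventually_at_right_less)
    show "\<forall>\<^sub>F \<epsilon> in at_right 0. \<epsilon> < \<delta>"
      using C(2) by (intro order_tendstoD(2)[of _ 0] tendsto_eq_intros) auto
    show "\<forall>\<^sub>F \<epsilon> in at_right 0. 2 * \<kappa> * \<epsilon> + (2 * \<kappa> + 4) * (C * \<epsilon> ^ 3) < d"
      using d by (intro order_tendstoD(2)[of _ 0]) (auto intro!: tendsto_eq_intros)
    show "\<forall>\<^sub>F \<epsilon> in at_right 0. K * \<epsilon> < 8 * \<kappa>\<^sup>2 * c0"
      using \<kappa> c0 by (intro order_tendstoD(2)[of _ 0]) (auto intro!: tendsto_eq_intros)
  qed
  then obtain \<epsilon> where \<epsilon>: "0 < \<epsilon>" "\<epsilon> < \<delta>"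
    "2 * \<kappa> * \<epsilon> + (2 * \<kappa> + 4) * (C * \<epsilon> ^ 3) < d" "K * \<epsilon> < 8 * \<kappa>\<^sup>2 * c0"
    using eventually_happens'[OF trivial_limit_at_right_real] by blast
  \<comment> \<open>This choice gives \<open>\<sigma> sgn \<phi>\<^sub>r - \<rho> sgn \<phi>\<^sub>s = - 2 sgn \<phi>\<^sub>r\<^sub>s\<close>, the sign that contradicts TVD.\<close>
  define \<sigma> \<rho> where "\<sigma> = - \<tau> * sr" and "\<rho> = \<tau> * ss"
  have unit': "\<bar>\<sigma>\<bar> = 1" "\<bar>\<rho>\<bar> = 1" using unit by (simp_all add: \<sigma>_def \<rho>_def abs_mult)
  define xm xr where "xm = x0 + \<sigma> * \<epsilon>" and "xr = xm - \<rho> * \<epsilon>"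
  have ax: "\<bar>xm - x0\<bar> = \<epsilon>" "\<bar>xr - xm\<bar> = \<epsilon>"
    using \<epsilon> unit' by (auto simp: xm_def xr_def abs_mult)
  define \<eta> where "\<eta> = C * \<epsilon> ^ 3"
  obtain xm' where pos: "xm > 0" "xr > 0" "xm' > 0"
    and \<theta>: "\<bar>xm' - (x0 + xr - xm)\<bar> \<le> \<eta>"
    and bal: "velocity_drop \<gamma> xm x0 + velocity_drop \<gamma> xm xr
          = velocity_drop \<gamma> x0 xm' + velocity_drop \<gamma> xr xm'"
    and up: "velocity_drop \<gamma> xm x0 \<le> \<kappa> * (x0 - xm) + \<eta>"
        "velocity_drop \<gamma> xm xr \<le> \<kappa> * (xr - xm) + \<eta>"
        "velocity_drop \<gamma> x0 xm' \<le> \<kappa> * (xm' - x0) + \<eta>"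
    using weak[OF \<epsilon>(1,2) ax] unfolding \<eta>_def by blast
  define e1 e2 e3 where "e1 = velocity_drop \<gamma> xm x0 - \<kappa> * (x0 - xm)"
    and "e2 = velocity_drop \<gamma> xm xr - \<kappa> * (xr - xm)"
    and "e3 = velocity_drop \<gamma> x0 xm' - \<kappa> * (xm' - x0)"
  have e: "0 \<le> e1" "e1 \<le> \<eta>" "0 \<le> e2" "e2 \<le> \<eta>" "0 \<le> e3" "e3 \<le> \<eta>"
    using up velocity_drop_ge_kappa[OF g pos(1), of x0] velocity_drop_ge_kappa[OF g pos(1), of xr]
      velocity_drop_ge_kappa[OF g x0, of xm']
    by (auto simp: e1_def e2_def e3_def \<kappa>_def)
  define a where "a = 2 * \<kappa> * \<epsilon>"
  have a: "a > 0" using \<kappa> \<epsilon> by (simp add: a_def)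
  define A B where "A = \<sigma> * a" and "B = \<rho> * a"
  have AB: "\<bar>A\<bar> = a" "\<bar>B\<bar> = a" using a unit' by (simp_all add: A_def B_def abs_mult)
  define t where "t = 2 * \<kappa> * (xm' - (x0 + xr - xm))"
  define G where "G = 2 * \<kappa> * \<eta>"
  have t: "\<bar>t\<bar> \<le> G"
    unfolding t_def G_def abs_mult using \<theta> \<kappa> by (intro mult_mono) auto
  have G: "a + G + 4 * \<eta> < d" "G \<ge> 0" "\<eta> \<ge> 0"
    using \<epsilon> C \<kappa> by (auto simp: a_def G_def \<eta>_def algebra_simps)
  define Um Ur Um' where "Um = (xm, u - velocity_drop \<gamma> xm x0)"
    and "Ur = (xr, u - velocity_drop \<gamma> xm x0 - velocity_drop \<gamma> xm xr)"
    and "Um' = (xm', u - velocity_drop \<gamma> x0 xm')"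
  have u0: "u - \<kappa> * x0 = r0" "u + \<kappa> * x0 = s0" using p_coords by (simp_all add: coords)
  have xA: "2 * \<kappa> * (xm - x0) = A" and xB: "2 * \<kappa> * (xm - xr) = B"
    by (simp_all add: A_def B_def a_def xm_def xr_def)
  have cM: "riemann_coords \<gamma> Um = (r0 - e1, s0 + A - e1)"
    using u0 xA by (simp add: coords Um_def e1_def algebra_simps)
  have cR: "riemann_coords \<gamma> Ur = (r0 + B - e1 - e2, s0 + A - e1 - e2)"
    using u0 xA xB by (simp add: coords Ur_def e1_def e2_def algebra_simps)
  have cM': "riemann_coords \<gamma> Um' = (r0 + B - t - e3, s0 - e3)"
    using u0 xB by (simp add: coords Um'_def e3_def t_def algebra_simps)
  have sqI: "(r, s) \<in> square d p" if "\<bar>r - r0\<bar> \<le> d" "\<bar>s - s0\<bar> \<le> d" for r s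
    using that by (auto simp: square_def p_eq abs_le_iff)
  note bounds = e G AB t
  have mem: "(r0, s0) \<in> square d p" "(r0, s0 + A) \<in> square d p" "(r0 + B, s0) \<in> square d p"
    "(r0 + B, s0 + A) \<in> square d p" "(r0 - e1, s0 + A - e1) \<in> square d p"
    "(r0 - e1 + B, s0 + A - e1) \<in> square d p"
    "(r0 + B - e1 - e2, s0 + A - e1 - e2) \<in> square d p"
    "(r0 + B - t - e3, s0 - e3) \<in> square d p"
    by (rule sqI; use bounds in linarith)+
  \<comment> \<open>The corners of the exact square; the actual states differ from them by \<open>O(\<epsilon>\<^sup>3)\<close>.\<close>
  define f00 f01 f10 f11 where "f00 = \<phi> (r0, s0)" and "f01 = \<phi> (r0, s0 + A)"
    and "f10 = \<phi> (r0 + B, s0)" and "f11 = \<phi> (r0 + B, s0 + A)"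
  define fM fR fM' where "fM = state_field \<gamma> \<phi> Um" and "fR = state_field \<gamma> \<phi> Ur"
    and "fM' = state_field \<gamma> \<phi> Um'"
  have fL: "state_field \<gamma> \<phi> (x0, u) = f00" by (simp add: state_field_def p_coords f00_def)
  have tvd_ineq: "\<bar>fM' - f00\<bar> + \<bar>fR - fM'\<bar> \<le> \<bar>fM - f00\<bar> + \<bar>fR - fM\<bar>"
    unfolding fM'_def fR_def fL[symmetric]
  proof (rule glimm_TVD_head_on[OF g tvd x0 pos _ _ bal Um_def Ur_def Um'_def])
    show "xm \<noteq> x0" "xr \<noteq> xm" using ax \<epsilon> by auto
    have "wave_state \<gamma> Forward (xm / x0) (x0, u) = Um"
      using pos x0 by (simp only: wave_state_forward[OF g] Um_def)
    then show "wave_variation \<gamma> \<phi> Forward (xm / x0) (x0, u)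
        \<le> ennreal \<bar>fM - state_field \<gamma> \<phi> (x0, u)\<bar>"
      using wave_variation_forward_le_jump[OF g C1(1) sq unit(2) ss0 x0 pos(1) \<open>xm \<noteq> x0\<close>, of u r0]
        mem(1,2) xA
      by (simp add: p_coords \<kappa>_def fM_def)
    have "wave_state \<gamma> Backward (xr / xm) Um = Ur"
      using pos by (simp only: wave_state_backward Um_def Ur_def)
    then show "wave_variation \<gamma> \<phi> Backward (xr / xm) Um \<le> ennreal \<bar>state_field \<gamma> \<phi> Ur - fM\<bar>"
      using wave_variation_backward_le_jump[OF g C1(1) sq unit(1) sr0 pos(1,2) \<open>xr \<noteq> xm\<close>,
          of "snd Um" "s0 + A - e1"] mem(5,6) xB cM
      by (simp add: \<kappa>_def fM_def Um_def)
  qed auto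
  have near_M: "\<bar>fM - f01\<bar> \<le> L * (2 * \<eta>)"
  proof -
    have "\<bar>fM - f01\<bar> \<le> L * (\<bar>(r0 - e1) - r0\<bar> + \<bar>(s0 + A - e1) - (s0 + A)\<bar>)"
      unfolding fM_def f01_def state_field_def cM by (rule L(2)[OF mem(2,5)])
    also have "\<dots> \<le> L * (2 * \<eta>)" using L(1) bounds by (intro mult_left_mono) linarith+
    finally show ?thesis .
  qed
  have near_R: "\<bar>fR - f11\<bar> \<le> L * (4 * \<eta>)"
  proof -
    have "\<bar>fR - f11\<bar> \<le> L * (\<bar>(r0 + B - e1 - e2) - (r0 + B)\<bar> + \<bar>(s0 + A - e1 - e2) - (s0 + A)\<bar>)"
      unfolding fR_def f11_def state_field_def cR by (rule L(2)[OF mem(4,7)])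
    also have "\<dots> \<le> L * (4 * \<eta>)" using L(1) bounds by (intro mult_left_mono) linarith+
    finally show ?thesis .
  qed
  have near_M': "\<bar>fM' - f10\<bar> \<le> L * (G + 2 * \<eta>)"
  proof -
    have "\<bar>fM' - f10\<bar> \<le> L * (\<bar>(r0 + B - t - e3) - (r0 + B)\<bar> + \<bar>(s0 - e3) - s0\<bar>)"
      unfolding fM'_def f10_def state_field_def cM' by (rule L(2)[OF mem(3,8)])
    also have "\<dots> \<le> L * (G + 2 * \<eta>)" using L(1) bounds by (intro mult_left_mono) linarith+
    finally show ?thesis .
  qed
  have sgn_in: "\<bar>f01 - f00\<bar> = ss * \<sigma> * (f01 - f00)"
    using difference_sign_s[OF C1(1) sq ss0 mem(1,2)] unit unit' a
    by (intro abs_eq_signed[of _ _ a]) (auto simp: A_def f01_def f00_def)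
  have sgn_in': "\<bar>f11 - f01\<bar> = sr * \<rho> * (f11 - f01)"
    using difference_sign_r[OF C1(1) sq sr0 mem(2,4)] unit unit' a
    by (intro abs_eq_signed[of _ _ a]) (auto simp: B_def f11_def f01_def)
  define P Q where "P = sr * \<rho>" and "Q = ss * \<sigma>"
  have PQ: "\<bar>P\<bar> = 1" "\<bar>Q\<bar> = 1" using unit unit' by (simp_all add: P_def Q_def abs_mult)
  have P: "P * x \<le> \<bar>x\<bar>" and Q: "Q * x \<le> \<bar>x\<bar>" for x
    using PQ abs_ge_self[of "P * x"] abs_ge_self[of "Q * x"] by (simp_all add: abs_mult)
  have "P * (f10 - f00) + Q * (f11 - f10)
      = P * (f10 - fM') + P * (fM' - f00) + Q * ((f11 - fR) + (fM' - f10)) + Q * (fR - fM')"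
    by (simp add: algebra_simps)
  also have "\<dots> \<le> \<bar>f10 - fM'\<bar> + \<bar>fM' - f00\<bar> + \<bar>(f11 - fR) + (fM' - f10)\<bar> + \<bar>fR - fM'\<bar>"
    by (intro add_mono P Q)
  also have "\<dots> \<le> \<bar>f01 - f00\<bar> + \<bar>f11 - f01\<bar>
      + 2 * \<bar>fM - f01\<bar> + 2 * \<bar>fR - f11\<bar> + 2 * \<bar>fM' - f10\<bar>"
    using tvd_ineq by (smt (verit))
  also have "\<dots> \<le> Q * (f01 - f00) + P * (f11 - f01)
      + 2 * (L * (2 * \<eta>)) + 2 * (L * (4 * \<eta>)) + 2 * (L * (G + 2 * \<eta>))"
    unfolding P_def Q_def using near_M near_R near_M' sgn_in sgn_in' by linarith
  finally have "(Q - P) * (f00 + f11 - f01 - f10) \<le> K * \<epsilon> ^ 3"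
    by (simp add: algebra_simps K_def G_def \<eta>_def)
  moreover obtain q where q: "q \<in> square d p"
    "f00 + f11 - f01 - f10 = B * A * partial_s (partial_r \<phi>) q"
    using mixed_difference_mean_value[OF C1, of r0 "r0 + B" s0 "s0 + A"]
      square_segments[OF mem(1,4)] sq
    by (auto simp: f00_def f01_def f10_def f11_def)
  ultimately have "(Q - P) * (B * A * partial_s (partial_r \<phi>) q) \<le> K * \<epsilon> ^ 3" by simp
  also have "(Q - P) * (B * A * partial_s (partial_r \<phi>) q)
      = (Q - P) * (\<rho> * \<sigma>) * a\<^sup>2 * partial_s (partial_r \<phi>) q"
    by (simp add: A_def B_def power2_eq_square)
  also have "(Q - P) * (\<rho> * \<sigma>) = 2 * \<tau>"
    using unit unfolding P_def Q_def \<sigma>_def \<rho>_def by (auto simp: abs_if split: if_splits)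
  finally have "2 * a\<^sup>2 * (\<tau> * partial_s (partial_r \<phi>) q) \<le> K * \<epsilon> ^ 3" by (simp add: algebra_simps)
  moreover have "2 * a\<^sup>2 * c0 \<le> 2 * a\<^sup>2 * (\<tau> * partial_s (partial_r \<phi>) q)"
    using \<tau>[OF q(1)] by (intro mult_left_mono) auto
  ultimately have "\<epsilon>\<^sup>2 * (8 * \<kappa>\<^sup>2 * c0) \<le> \<epsilon>\<^sup>2 * (K * \<epsilon>)"
    by (simp add: a_def power2_eq_square power3_eq_cube algebra_simps)
  then show False using \<epsilon> by simp
qed

text \<open>
  Where \<open>\<phi>\<^sub>r\<^sub>s \<noteq> 0\<close>, neither first derivative can vanish on an open set, so arbitrarily close by
  there is a point where all three derivatives are nonzero.
\<close>

lemma mixed_partial_eq_0: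
  assumes g: "\<gamma> > 1" and C2: "C2_on no_vacuum \<phi>" and tvd: "glimm_TVD \<gamma> \<phi>"
    and p: "p \<in> no_vacuum"
  shows "partial_s (partial_r \<phi>) p = 0"
proof (rule ccontr)
  assume nz: "partial_s (partial_r \<phi>) p \<noteq> 0"
  have C1: "C1_on no_vacuum \<phi>" "C1_on no_vacuum (partial_r \<phi>)"
    and cont: "continuous_on no_vacuum (partial_s \<phi>)"
      "continuous_on no_vacuum (partial_s (partial_r \<phi>))"
    using C2 by (auto simp: C2_on_def C1_on_def)
  have good: "\<exists>d>0. square d q \<subseteq> no_vacuum \<and> (\<forall>z \<in> square d q. f z \<noteq> 0)"
    if "q \<in> no_vacuum" "continuous_on no_vacuum f" "f q \<noteq> 0" for f :: "real \<times> real \<Rightarrow> real" and q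
  proof -
    have "\<forall>\<^sub>F d in at_right 0. d > 0 \<and> square d q \<subseteq> no_vacuum
        \<and> (\<forall>z \<in> square d q. \<bar>f q\<bar> / 2 < sgn (f q) * f z)"
      by (intro eventually_conj eventually_at_right_less eventually_square
          eventually_square_sgn[OF open_no_vacuum] open_no_vacuum that)
    then obtain d where "d > 0" "square d q \<subseteq> no_vacuum"
      "\<forall>z \<in> square d q. \<bar>f q\<bar> / 2 < sgn (f q) * f z"
      using eventually_happens'[OF trivial_limit_at_right_real] by blast
    then show ?thesis by (intro exI[of _ d]) force
  qed
  obtain d where d: "d > 0" "square d p \<subseteq> no_vacuum"
    and nz_sq: "\<And>q. q \<in> square d p \<Longrightarrow> partial_s (partial_r \<phi>) q \<noteq> 0"
    using good[OF p cont(2) nz] by blast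
  \<comment> \<open>A field independent of \<open>s\<close> on the square has no mixed differences there.\<close>
  have "\<exists>q \<in> square d p. partial_s \<phi> q \<noteq> 0"
  proof (rule ccontr)
    assume "\<not> ?thesis"
    then have z: "partial_s \<phi> q = 0" if "q \<in> square d p" for q using that by blast
    obtain r s where rs: "p = (r, s)" by (cases p)
    have mem: "(r, s) \<in> square d p" "(r, s + d) \<in> square d p" "(r + d, s) \<in> square d p"
      "(r + d, s + d) \<in> square d p"
      using d by (auto simp: rs square_def)
    have const: "\<phi> (x, s + d) = \<phi> (x, s)" if "(x, s) \<in> square d p" "(x, s + d) \<in> square d p" for x
    proof -
      have "0 \<le> c * (s + d - s) * (\<phi> (x, s + d) - \<phi> (x, s))" for c
        using that by (intro difference_sign_s[OF C1(1) d(2)]) (auto simp: z)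
      from this[of 1] this[of "-1"] show ?thesis using d by (simp add: zero_le_mult_iff mult_le_0_iff)
    qed
    obtain q where q: "q \<in> square d p"
      "\<phi> (r, s) + \<phi> (r + d, s + d) - \<phi> (r, s + d) - \<phi> (r + d, s)
        = (r + d - r) * (s + d - s) * partial_s (partial_r \<phi>) q"
      using mixed_difference_mean_value[OF C1, of r "r + d" s "s + d"]
        square_segments[OF mem(1,4)] d(2) by blast
    then show False using const[OF mem(1,2)] const[OF mem(3,4)] nz_sq d by auto
  qed
  then obtain q where q: "q \<in> square d p" "partial_s \<phi> q \<noteq> 0" by blast
  then have "q \<in> no_vacuum" using d by blast
  then obtain e where e: "e > 0" "square e q \<subseteq> no_vacuum"
    and nz_s: "\<And>z. z \<in> square e q \<Longrightarrow> partial_s \<phi> z \<noteq> 0"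
    using good[OF _ cont(1) q(2)] by blast
  obtain e' where e': "e' > 0" "square e' q \<subseteq> no_vacuum"
    and nz_rs: "\<And>z. z \<in> square e' q \<Longrightarrow> partial_s (partial_r \<phi>) z \<noteq> 0"
    using good[OF \<open>q \<in> no_vacuum\<close> cont(2) nz_sq[OF q(1)]] by blast
  define h where "h = min e e'"
  have h: "h > 0" "square h q \<subseteq> square e q" "square h q \<subseteq> square e' q"
    using e e' by (auto simp: h_def intro!: square_mono)
  obtain r s where rs: "q = (r, s)" by (cases q)
  have mem: "(r, s) \<in> square h q" "(r, s + h) \<in> square h q" using h by (auto simp: rs square_def)
  note seg = square_segments[OF mem]
  have "((\<lambda>x. partial_r \<phi> (r, x)) has_real_derivative partial_s (partial_r \<phi>) (r, x)) (at x)"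
    if "x \<in> closed_segment s (s + h)" for x
    by (rule C1_on_derivatives[OF C1(2)]) (use that seg h e in auto)
  from mean_value_segment[OF this] obtain y where "y \<in> closed_segment s (s + h)"
    "partial_r \<phi> (r, s + h) - partial_r \<phi> (r, s) = (s + h - s) * partial_s (partial_r \<phi>) (r, y)"
    by blast
  moreover have "partial_s (partial_r \<phi>) (r, y) \<noteq> 0" if "y \<in> closed_segment s (s + h)"
    using that seg h by (intro nz_rs) auto
  ultimately have "partial_r \<phi> (r, s + h) \<noteq> 0 \<or> partial_r \<phi> (r, s) \<noteq> 0" using h by auto
  then obtain z where z: "z \<in> square h q" "partial_r \<phi> z \<noteq> 0" using mem by blast
  moreover have "z \<in> no_vacuum" "partial_s \<phi> z \<noteq> 0" "partial_s (partial_r \<phi>) z \<noteq> 0"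
    using z(1) h(2,3) e(2) nz_s[of z] nz_rs[of z] by blast+
  ultimately show False using mixed_partial_eq_0_if_gradient_nonzero[OF g C2 tvd] by blast
qed

text \<open>
  The field is a sum of a function of \<open>r\<close> and a function of \<open>s\<close>. In this form, values close to the
  vacuum line \<open>r = s\<close> are expressed by values at a distance from it, where \<open>\<phi>\<close> is smooth.
\<close>

lemma glimm_TVD_separates:
  assumes g: "\<gamma> > 1" and C2: "C2_on no_vacuum \<phi>" and tvd: "glimm_TVD \<gamma> \<phi>"
    and "r < s" "r < s'" "r' < s" "r' < s'"
  shows "\<phi> (r', s') = \<phi> (r', s) + \<phi> (r, s') - \<phi> (r, s)"
proof -
  have C1: "C1_on no_vacuum \<phi>" "C1_on no_vacuum (partial_r \<phi>)"
    using C2 by (auto simp: C2_on_def)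
  have seg: "closed_segment r r' \<times> closed_segment s s' \<subseteq> no_vacuum"
    using assms(4-7) by (auto simp: no_vacuum_def closed_segment_eq_real_ivl split: if_splits)
  obtain q where "q \<in> closed_segment r r' \<times> closed_segment s s'"
    "\<phi> (r, s) + \<phi> (r', s') - \<phi> (r, s') - \<phi> (r', s)
      = (r' - r) * (s' - s) * partial_s (partial_r \<phi>) q"
    using mixed_difference_mean_value[OF C1 seg] by blast
  then show ?thesis using mixed_partial_eq_0[OF g C2 tvd, of q] seg by auto
qed

section \<open>Blow-up at a vacuum point\<close>

text \<open>
  The system is invariant under dilations of \<open>(\<xi>, u)\<close> and translations of \<open>u\<close>. As \<open>t\<close> tends to
  \<open>0\<close>, the rescaled states shrink to the vacuum point with velocity \<open>q\<close>.
\<close>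

definition rescale :: "real \<Rightarrow> real \<Rightarrow> state \<Rightarrow> state" where
  "rescale t q U = (t * fst U, q + t * snd U)"

text \<open>
  Interactions whose incoming waves are both shocks. For these the TVD condition implies an
  inequality between finitely many values of the field, which is stable under limits.
\<close>

definition shock_interaction :: "real \<Rightarrow> state \<Rightarrow> state \<Rightarrow> state \<Rightarrow> state \<Rightarrow> bool" where
  "shock_interaction \<gamma> Ul Um Ur Um' \<longleftrightarrow> fst Ul > 0 \<and>
    (\<exists>k x k' x' b f. x > 0 \<and> x' > 0 \<and> is_shock k x \<and> is_shock k' x' \<and> approaching k x k' x'
      \<and> wave_state \<gamma> k x Ul = Um \<and> wave_state \<gamma> k' x' Um = Ur
      \<and> b > 0 \<and> f > 0 \<and> wave_state \<gamma> Backward b Ul = Um' \<and> wave_state \<gamma> Forward f Um' = Ur)"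

lemma wave_state_rescale: "wave_state \<gamma> k x (rescale t q U) = rescale t q (wave_state \<gamma> k x U)"
  by (cases k; cases U) (auto simp: rescale_def algebra_simps)

lemma fst_wave_state: "fst (wave_state \<gamma> k x U) = x * fst U"
  by (cases k; cases U) auto

lemma shock_interaction_rescale:
  "t > 0 \<Longrightarrow> shock_interaction \<gamma> Ul Um Ur Um' \<Longrightarrow>
    shock_interaction \<gamma> (rescale t q Ul) (rescale t q Um) (rescale t q Ur) (rescale t q Um')"
  unfolding shock_interaction_def
  by (auto simp: wave_state_rescale) (force simp: rescale_def, metis wave_state_rescale)

lemma shock_interaction_pos:
  assumes "shock_interaction \<gamma> Ul Um Ur Um'"
  shows "fst Ul > 0" "fst Um > 0" "fst Ur > 0" "fst Um' > 0"
  using assms unfolding shock_interaction_def by (auto simp: fst_wave_state)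

lemma glimm_TVD_shock_interaction:
  fixes \<phi> \<gamma>
  assumes tvd: "glimm_TVD \<gamma> \<phi>" and "shock_interaction \<gamma> Ul Um Ur Um'"
  shows "\<bar>state_field \<gamma> \<phi> Um' - state_field \<gamma> \<phi> Ul\<bar> + \<bar>state_field \<gamma> \<phi> Ur - state_field \<gamma> \<phi> Um'\<bar>
    \<le> \<bar>state_field \<gamma> \<phi> Um - state_field \<gamma> \<phi> Ul\<bar> + \<bar>state_field \<gamma> \<phi> Ur - state_field \<gamma> \<phi> Um\<bar>"
proof -
  obtain k x k' x' b f where *: "x > 0" "x' > 0" "is_shock k x" "is_shock k' x'"
    "approaching k x k' x'" "wave_state \<gamma> k x Ul = Um" "wave_state \<gamma> k' x' Um = Ur"
    "b > 0" "f > 0" "wave_state \<gamma> Backward b Ul = Um'" "wave_state \<gamma> Forward f Um' = Ur"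
    and "fst Ul > 0"
    using assms(2) unfolding shock_interaction_def by blast
  have "x \<noteq> 1" "x' \<noteq> 1" using *(3,4) by (cases k; cases k'; auto)+
  then show ?thesis
    by (intro glimm_TVD_jumps[OF tvd \<open>fst Ul > 0\<close> *(1) _ *(2) _ *(5-11)])
      (use * in \<open>auto simp: wave_variation_shock\<close>)
qed

definition linear_field :: "real \<Rightarrow> real \<Rightarrow> real \<Rightarrow> state \<Rightarrow> real" where
  "linear_field \<gamma> a b = state_field \<gamma> (\<lambda>(r, s). a * r + b * s)"

text \<open>
  The smoothness of \<open>\<phi>\<close> ends at the vacuum point \<open>(q, q)\<close>, but its two summands are
  differentiable there. Near that point the field is asymptotically the linear function of
  \<open>(r, s)\<close> whose coefficients are the derivatives of the summands.
\<close>

lemma state_field_blow_up: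
  assumes g: "\<gamma> > 1" and C2: "C2_on no_vacuum \<phi>" and tvd: "glimm_TVD \<gamma> \<phi>"
    and q: "R < q" "q < S" and U: "fst U > 0"
  defines "c \<equiv> \<phi> (q, S) + \<phi> (R, q) - \<phi> (R, S)"
  shows "((\<lambda>t. (state_field \<gamma> \<phi> (rescale t q U) - c) / t)
    \<longlongrightarrow> linear_field \<gamma> (partial_r \<phi> (q, S)) (partial_s \<phi> (R, q)) U) (at_right 0)"
proof -
  obtain r s where rs: "riemann_coords \<gamma> U = (r, s)" by force
  have "r < s" using rs U kappa_pos[OF g] by (cases U) (auto simp: riemann_coords_def)
  have coords: "riemann_coords \<gamma> (rescale t q U) = (q + t * r, q + t * s)" for t
    using rs by (cases U) (auto simp: riemann_coords_def rescale_def algebra_simps)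
  have C1: "C1_on no_vacuum \<phi>" using C2 by (auto simp: C2_on_def)
  define G where "G = (\<lambda>t. \<phi> (q + t * r, S) + \<phi> (R, q + t * s) - \<phi> (R, S))"
  have "((\<lambda>y. \<phi> (y, S)) has_real_derivative partial_r \<phi> (q, S)) (at (q + 0 * r))"
    "((\<lambda>y. \<phi> (R, y)) has_real_derivative partial_s \<phi> (R, q)) (at (q + 0 * s))"
    using C1_on_derivatives[OF C1] q by (auto simp: no_vacuum_def)
  then have "(G has_real_derivative partial_r \<phi> (q, S) * r + partial_s \<phi> (R, q) * s) (at 0)"
    unfolding G_def by (auto intro!: derivative_eq_intros DERIV_chain2[where f = "\<lambda>y. \<phi> (y, S)"]
        DERIV_chain2[where f = "\<lambda>y. \<phi> (R, y)"])
  then have "((\<lambda>t. (G t - G 0) / t) \<longlongrightarrow> partial_r \<phi> (q, S) * r + partial_s \<phi> (R, q) * s) (at 0)"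
    by (simp add: DERIV_def)
  then have lim: "((\<lambda>t. (G t - c) / t) \<longlongrightarrow> linear_field \<gamma> (partial_r \<phi> (q, S)) (partial_s \<phi> (R, q)) U)
      (at_right 0)"
    by (auto simp: G_def c_def linear_field_def state_field_def rs intro: filterlim_mono at_le)
  have "\<forall>\<^sub>F t in at_right 0. t > 0 \<and> R < q + t * s \<and> q + t * r < S"
  proof (intro eventually_conj eventually_at_right_less)
    show "\<forall>\<^sub>F t in at_right 0. R < q + t * s"
      using q by (intro order_tendstoD(1)[of _ q]) (auto intro!: tendsto_eq_intros)
    show "\<forall>\<^sub>F t in at_right 0. q + t * r < S"
      using q by (intro order_tendstoD(2)[of _ q]) (auto intro!: tendsto_eq_intros)
  qed
  then have "\<forall>\<^sub>F t in at_right 0. (G t - c) / t = (state_field \<gamma> \<phi> (rescale t q U) - c) / t"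
  proof eventually_elim
    case (elim t)
    have "\<phi> (q + t * r, q + t * s) = G t"
      unfolding G_def
      using glimm_TVD_separates[OF g C2 tvd, of R S "q + t * s" "q + t * r"] elim q \<open>r < s\<close> by auto
    then show ?case by (simp add: state_field_def coords)
  qed
  then show ?thesis using lim by (rule Lim_transform_eventually[rotated])
qed

lemma linear_field_shock_interaction:
  assumes g: "\<gamma> > 1" and C2: "C2_on no_vacuum \<phi>" and tvd: "glimm_TVD \<gamma> \<phi>"
    and q: "R < q" "q < S" and shock: "shock_interaction \<gamma> Ul Um Ur Um'"
  defines "J \<equiv> linear_field \<gamma> (partial_r \<phi> (q, S)) (partial_s \<phi> (R, q))"
  shows "\<bar>J Um' - J Ul\<bar> + \<bar>J Ur - J Um'\<bar> \<le> \<bar>J Um - J Ul\<bar> + \<bar>J Ur - J Um\<bar>"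
proof -
  define c where "c = \<phi> (q, S) + \<phi> (R, q) - \<phi> (R, S)"
  define H where "H = (\<lambda>U t. (state_field \<gamma> \<phi> (rescale t q U) - c) / t)"
  have lim: "(H U \<longlongrightarrow> J U) (at_right 0)" if "fst U > 0" for U
    using state_field_blow_up[OF g C2 tvd q that] by (simp add: H_def J_def c_def)
  note lims = lim[OF shock_interaction_pos(1)[OF shock]] lim[OF shock_interaction_pos(2)[OF shock]]
    lim[OF shock_interaction_pos(3)[OF shock]] lim[OF shock_interaction_pos(4)[OF shock]]
  have "\<forall>\<^sub>F t :: real in at_right 0. t > 0" by (rule eventually_at_right_less)
  then have ev: "\<forall>\<^sub>F t in at_right 0. \<bar>H Um' t - H Ul t\<bar> + \<bar>H Ur t - H Um' t\<bar>
      \<le> \<bar>H Um t - H Ul t\<bar> + \<bar>H Ur t - H Um t\<bar>"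
  proof eventually_elim
    case (elim t)
    have *: "\<bar>H U t - H V t\<bar>
        = \<bar>state_field \<gamma> \<phi> (rescale t q U) - state_field \<gamma> \<phi> (rescale t q V)\<bar> / t" for U V
      using elim by (simp add: H_def flip: diff_divide_distrib)
    show ?case
      unfolding * add_divide_distrib[symmetric]
      using elim glimm_TVD_shock_interaction[OF tvd shock_interaction_rescale[OF elim shock]]
      by (intro divide_right_mono) auto
  qed
  show ?thesis
    by (rule tendsto_le[OF trivial_limit_at_right_real _ _ ev]) (intro tendsto_intros lims)+
qed

section \<open>Linear fields\<close>

text \<open>
  The middle value of \<open>\<xi>\<close> after a shock from \<open>\<xi> = 1\<close> to \<open>\<xi> = 2\<close> merges with one from \<open>2\<close> to \<open>3\<close>.
  Since it stays below \<open>3\<close>, the reflected wave is a rarefaction of positive strength.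
\<close>

lemma overtaking_balance:
  assumes g: "\<gamma> > 1"
  obtains m where "2 < m" "m < 3"
    "velocity_drop \<gamma> 1 m + kappa \<gamma> * (m - 3) = velocity_drop \<gamma> 1 2 + velocity_drop \<gamma> 2 3"
proof -
  define V where "V = (\<lambda>y. velocity_drop \<gamma> 1 y + kappa \<gamma> * (y - 3))"
  define T where "T = velocity_drop \<gamma> 1 2 + velocity_drop \<gamma> 2 3"
  have lo: "V 2 < T"
    using kappa_pos[OF g] velocity_drop_gt_kappa[OF g, of 2 3] by (simp add: V_def T_def)
  have hi: "T < V 3"
    using velocity_drop_superadditive[OF g, of 1 2 3] by (simp add: V_def T_def)
  have "continuous_on {2..3} V"
    unfolding V_def
    by (intro continuous_intros continuous_on_subset[OF continuous_on_velocity_drop]) auto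
  then obtain m where "2 \<le> m" "m \<le> 3" "V m = T"
    using IVT'[of V 2 T 3] lo hi by auto
  moreover have "m \<noteq> 2" "m \<noteq> 3" using calculation lo hi by auto
  ultimately show ?thesis by (intro that[of m]) (auto simp: V_def T_def)
qed

lemma linear_field_eq:
  "linear_field \<gamma> a b (\<xi>, w) = a * (w - kappa \<gamma> * \<xi>) + b * (w + kappa \<gamma> * \<xi>)"
  by (simp add: linear_field_def state_field_def riemann_coords_def)

text \<open>
  Both \<open>r\<close> and \<open>s\<close> decrease across every shock. If \<open>a\<close> and \<open>b\<close> do not have opposite signs, the
  incoming variation of \<open>a r + b s\<close> across two shocks of one family is just the total jump. After
  the interaction, a reflected rarefaction runs back against this direction in one of the two
  coordinates and makes the outgoing variation strictly larger unless the coefficient of that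
  coordinate is zero. Backward shocks reflect in \<open>s\<close>, forward shocks in \<open>r\<close>.
\<close>

lemma linear_field_overtaking:
  assumes g: "\<gamma> > 1" and ab: "0 \<le> a * b"
    and ineq: "\<And>Ul Um Ur Um'. shock_interaction \<gamma> Ul Um Ur Um' \<Longrightarrow>
      \<bar>linear_field \<gamma> a b Um' - linear_field \<gamma> a b Ul\<bar> + \<bar>linear_field \<gamma> a b Ur - linear_field \<gamma> a b Um'\<bar>
      \<le> \<bar>linear_field \<gamma> a b Um - linear_field \<gamma> a b Ul\<bar> + \<bar>linear_field \<gamma> a b Ur - linear_field \<gamma> a b Um\<bar>"
  shows "a = 0 \<and> b = 0"
proof -
  define \<kappa> where "\<kappa> = kappa \<gamma>"
  have \<kappa>: "\<kappa> > 0" using kappa_pos[OF g] by (simp add: \<kappa>_def)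
  obtain m where m: "2 < m" "m < 3"
    "velocity_drop \<gamma> 1 m + kappa \<gamma> * (m - 3) = velocity_drop \<gamma> 1 2 + velocity_drop \<gamma> 2 3"
    using overtaking_balance[OF g] by blast
  define V1 V2 where "V1 = velocity_drop \<gamma> 1 2" and "V2 = velocity_drop \<gamma> 2 3"
  define W where "W = V1 + V2"
  define V' where "V' = velocity_drop \<gamma> 1 m"
  have V': "V' = W + \<kappa> * (3 - m)" using m(3) by (simp add: V'_def W_def V1_def V2_def \<kappa>_def algebra_simps)
  have V: "V1 > \<kappa>" "V2 > \<kappa>" "V' > \<kappa> * (m - 1)"
    using velocity_drop_gt_kappa[OF g, of 1 2] velocity_drop_gt_kappa[OF g, of 2 3]
      velocity_drop_gt_kappa[OF g, of 1 m] m by (auto simp: V1_def V2_def V'_def \<kappa>_def)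
  define J where "J = linear_field \<gamma> a b"
  have J: "J (x, w) = a * (w - \<kappa> * x) + b * (w + \<kappa> * x)" for x w
    by (simp add: J_def linear_field_eq \<kappa>_def)
  \<comment> \<open>The same \<open>m\<close> resolves the mirror image, because the velocity drop is common to both families.\<close>
  have rare: "velocity_drop \<gamma> 3 m = \<kappa> * (m - 3)"
    using m by (simp add: velocity_drop_rarefaction \<kappa>_def)
  have "shock_interaction \<gamma> (1, 0) (2, - V1) (3, - W) (m, - V')"
    unfolding shock_interaction_def
  proof (intro conjI exI)
    show "wave_state \<gamma> Backward (2 / 1) (1, 0) = (2, - V1)"
      "wave_state \<gamma> Backward (3 / 2) (2, - V1) = (3, - W)"
      "wave_state \<gamma> Backward (m / 1) (1, 0) = (m, - V')"
      by (subst wave_state_backward; simp add: V1_def V2_def V'_def W_def)+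
    show "wave_state \<gamma> Forward (3 / m) (m, - V') = (3, - W)"
      by (subst wave_state_forward[OF g]) (use m rare V' in \<open>simp_all add: algebra_simps\<close>)
  qed (use m in \<open>auto simp: approaching_def\<close>)
  from ineq[OF this]
  have 1: "\<bar>J (m, - V') - J (1, 0)\<bar> + \<bar>J (3, - W) - J (m, - V')\<bar>
      \<le> \<bar>J (2, - V1) - J (1, 0)\<bar> + \<bar>J (3, - W) - J (2, - V1)\<bar>" by (simp add: J_def)
  have "shock_interaction \<gamma> (3, 0) (2, - V2) (1, - W) (m, \<kappa> * (3 - m))"
    unfolding shock_interaction_def
  proof (intro conjI exI)
    show "wave_state \<gamma> Forward (2 / 3) (3, 0) = (2, - V2)"
      "wave_state \<gamma> Forward (1 / 2) (2, - V2) = (1, - W)"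
      by (subst wave_state_forward[OF g]; simp add: V1_def V2_def W_def)+
    show "wave_state \<gamma> Backward (m / 3) (3, 0) = (m, \<kappa> * (3 - m))"
      by (subst wave_state_backward) (simp_all add: rare algebra_simps)
    show "wave_state \<gamma> Forward (1 / m) (m, \<kappa> * (3 - m)) = (1, - W)"
      by (subst wave_state_forward[OF g]) (use m V' in \<open>simp_all flip: V'_def\<close>)
  qed (use m in \<open>auto simp: approaching_def\<close>)
  from ineq[OF this]
  have 2: "\<bar>J (m, \<kappa> * (3 - m)) - J (3, 0)\<bar> + \<bar>J (1, - W) - J (m, \<kappa> * (3 - m))\<bar>
      \<le> \<bar>J (2, - V2) - J (3, 0)\<bar> + \<bar>J (1, - W) - J (2, - V2)\<bar>" by (simp add: J_def)
  have same_sign: "\<bar>a * x + b * y\<bar> = \<bar>a\<bar> * x + \<bar>b\<bar> * y" if "0 \<le> x" "0 \<le> y" for x y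
  proof -
    have "0 \<le> (a * x) * (b * y)" using mult_nonneg_nonneg[OF ab mult_nonneg_nonneg[OF that]]
      by (simp add: algebra_simps)
    then have "\<bar>a * x + b * y\<bar> = \<bar>a * x\<bar> + \<bar>b * y\<bar>" by (auto simp: zero_le_mult_iff)
    then show ?thesis using that by (simp add: abs_mult)
  qed
  have step: "\<bar>J (x, w) - J (x', w')\<bar>
      = \<bar>a\<bar> * (w - w' - \<kappa> * (x - x')) + \<bar>b\<bar> * (w - w' + \<kappa> * (x - x'))"
    if "0 \<le> w - w' - \<kappa> * (x - x')" "0 \<le> w - w' + \<kappa> * (x - x')" for x w x' w'
    unfolding same_sign[OF that, symmetric] by (simp add: J algebra_simps)
  have rise: "\<bar>J (x, w) - J (x', w')\<bar> = \<bar>a\<bar> * y + \<bar>b\<bar> * z"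
    if "w - w' - \<kappa> * (x - x') = y" "w - w' + \<kappa> * (x - x') = z" "0 \<le> y" "0 \<le> z" for x w x' w' y z
    using step[of w w' x x'] that by simp
  have fall: "\<bar>J (x, w) - J (x', w')\<bar> = \<bar>a\<bar> * y + \<bar>b\<bar> * z"
    if "w' - w - \<kappa> * (x' - x) = y" "w' - w + \<kappa> * (x' - x) = z" "0 \<le> y" "0 \<le> z" for x w x' w' y z
    using rise[OF that] by (simp add: abs_minus_commute)
  have \<kappa>m: "0 < \<kappa> * (3 - m)" "0 < \<kappa> * (m - 1)"
    using \<kappa> m by simp_all
  have V'0: "0 < V' + \<kappa> * (m - 1)" using V(3) \<kappa>m by linarith
  have b: "\<bar>J (m, - V') - J (1, 0)\<bar> = \<bar>a\<bar> * (V' + \<kappa> * (m - 1)) + \<bar>b\<bar> * (V' - \<kappa> * (m - 1))"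
    "\<bar>J (2, - V1) - J (1, 0)\<bar> = \<bar>a\<bar> * (V1 + \<kappa>) + \<bar>b\<bar> * (V1 - \<kappa>)"
    "\<bar>J (3, - W) - J (2, - V1)\<bar> = \<bar>a\<bar> * (V2 + \<kappa>) + \<bar>b\<bar> * (V2 - \<kappa>)"
    by (rule fall; use V V'0 \<kappa> \<kappa>m in \<open>simp add: W_def algebra_simps\<close>)+
  have b': "\<bar>J (3, - W) - J (m, - V')\<bar> = \<bar>a\<bar> * 0 + \<bar>b\<bar> * (2 * (\<kappa> * (3 - m)))"
    by (rule rise; use V' \<kappa> m in \<open>simp add: algebra_simps\<close>)
  have f: "\<bar>J (1, - W) - J (m, \<kappa> * (3 - m))\<bar>
      = \<bar>a\<bar> * (V' - \<kappa> * (m - 1)) + \<bar>b\<bar> * (V' + \<kappa> * (m - 1))"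
    "\<bar>J (2, - V2) - J (3, 0)\<bar> = \<bar>a\<bar> * (V2 - \<kappa>) + \<bar>b\<bar> * (V2 + \<kappa>)"
    "\<bar>J (1, - W) - J (2, - V2)\<bar> = \<bar>a\<bar> * (V1 - \<kappa>) + \<bar>b\<bar> * (V1 + \<kappa>)"
    by (rule fall; use V V' \<kappa> \<kappa>m in \<open>simp add: W_def algebra_simps\<close>)+
  have f': "\<bar>J (m, \<kappa> * (3 - m)) - J (3, 0)\<bar> = \<bar>a\<bar> * (2 * (\<kappa> * (3 - m))) + \<bar>b\<bar> * 0"
    by (rule rise; use \<kappa> m in \<open>simp add: algebra_simps\<close>)
  have "\<bar>b\<bar> * (4 * \<kappa> * (3 - m)) \<le> 0"
    using 1[unfolded b b'] unfolding V' W_def by (simp add: algebra_simps)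
  then have "b = 0" using \<kappa> m by (auto simp: mult_le_0_iff)
  have "\<bar>a\<bar> * (4 * \<kappa> * (3 - m)) \<le> 0"
    using 2[unfolded f f'] unfolding V' W_def by (simp add: algebra_simps)
  then have "a = 0" using \<kappa> m by (auto simp: mult_le_0_iff)
  with \<open>b = 0\<close> show ?thesis by simp
qed

text \<open>
  Two equal shocks collide head-on, with \<open>\<xi> = 1\<close> on both sides, \<open>\<xi> = m < 1\<close> between them before and
  \<open>\<xi> = m' > 1\<close> between them after the collision. All four waves have the same velocity drop, but
  the outgoing shocks have the smaller ratio of \<open>\<xi>\<close> and hence the smaller slope, so that
  \<open>m' - 1 > 1 - m\<close>. A linear field with coefficients of opposite signs depends more on
  \<open>\<kappa> \<xi>\<close> than on \<open>u\<close>, and for weak shocks its jumps have the signs of the jumps of \<open>\<xi>\<close>. The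
  variation thus increases.
\<close>

lemma linear_field_head_on:
  assumes g: "\<gamma> > 1" and ab: "a * b < 0"
    and ineq: "\<And>Ul Um Ur Um'. shock_interaction \<gamma> Ul Um Ur Um' \<Longrightarrow>
      \<bar>linear_field \<gamma> a b Um' - linear_field \<gamma> a b Ul\<bar> + \<bar>linear_field \<gamma> a b Ur - linear_field \<gamma> a b Um'\<bar>
      \<le> \<bar>linear_field \<gamma> a b Um - linear_field \<gamma> a b Ul\<bar> + \<bar>linear_field \<gamma> a b Ur - linear_field \<gamma> a b Um\<bar>"
  shows False
proof -
  define \<kappa> where "\<kappa> = kappa \<gamma>"
  have \<kappa>: "\<kappa> > 0" using kappa_pos[OF g] by (simp add: \<kappa>_def)
  define A B where "A = \<bar>a + b\<bar>" and "B = \<bar>b - a\<bar>"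
  have AB: "A < B" "0 \<le> A" using ab by (auto simp: A_def B_def abs_if mult_less_0_iff)
  obtain C where C: "C > 0" "\<And>z. 1 < z \<Longrightarrow> z \<le> 2 \<Longrightarrow> shock_slope \<gamma> z \<le> \<kappa> + C * (z - 1)\<^sup>2"
    using shock_slope_upper[OF g] unfolding \<kappa>_def by blast
  have "\<forall>\<^sub>F z in at_right 1. 1 < z \<and> z < 2 \<and> A * (\<kappa> + C * (z - 1)\<^sup>2) < B * \<kappa>"
  proof (intro eventually_conj eventually_at_right_less)
    show "\<forall>\<^sub>F z :: real in at_right 1. z < 2"
      by (intro order_tendstoD(2)[of _ 1]) (auto intro!: tendsto_eq_intros)
    show "\<forall>\<^sub>F z in at_right 1. A * (\<kappa> + C * (z - 1)\<^sup>2) < B * \<kappa>"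
      using AB \<kappa> by (intro order_tendstoD(2)[of _ "A * \<kappa>"]) (auto intro!: tendsto_eq_intros)
  qed
  then obtain z where z: "1 < z" "z < 2" "A * (\<kappa> + C * (z - 1)\<^sup>2) < B * \<kappa>"
    using eventually_happens'[OF trivial_limit_at_right_real] by blast
  define m where "m = 1 / z"
  have m: "0 < m" "m < 1" using z by (auto simp: m_def)
  define D where "D = velocity_drop \<gamma> m 1"
  have D: "D = (1 - m) * shock_slope \<gamma> z"
    using m z unfolding D_def by (subst velocity_drop_shock[OF g]) (auto simp: m_def)
  have slope: "shock_slope \<gamma> z > 0" using shock_slope_gt_kappa[OF g z(1)] kappa_pos[OF g] by simp
  have "D > 0" using D m slope by simp
  \<comment> \<open>By homogeneity the shock from \<open>1\<close> to \<open>z = 1 / m\<close> drops more than the one from \<open>m\<close> to \<open>1\<close>,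
    so the outgoing ratio \<open>m'\<close> is less than the incoming ratio \<open>z\<close>.\<close>
  have "velocity_drop \<gamma> m 1 = m * velocity_drop \<gamma> 1 z"
    using velocity_drop_scale[OF m(1), of \<gamma> 1 z] z by (simp add: m_def)
  then have "D < velocity_drop \<gamma> 1 z"
    using \<open>D > 0\<close> m unfolding D_def[symmetric] by (simp add: zero_less_mult_iff mult_less_cancel_right1)
  moreover have "velocity_drop \<gamma> 1 1 = 0" by (simp add: velocity_drop_rarefaction)
  moreover have "continuous_on {1..z} (velocity_drop \<gamma> 1)"
    by (intro continuous_on_subset[OF continuous_on_velocity_drop]) auto
  ultimately obtain m' where "1 \<le> m'" "m' \<le> z" "velocity_drop \<gamma> 1 m' = D"
    using IVT'[of "velocity_drop \<gamma> 1" 1 D z] \<open>D > 0\<close> z by auto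
  moreover have "m' \<noteq> 1" "m' \<noteq> z"
    using calculation \<open>D > 0\<close> \<open>D < velocity_drop \<gamma> 1 z\<close> \<open>velocity_drop \<gamma> 1 1 = 0\<close> by auto
  ultimately have m': "1 < m'" "m' < z" "velocity_drop \<gamma> 1 m' = D" by auto
  have slope': "shock_slope \<gamma> m' < shock_slope \<gamma> z" "shock_slope \<gamma> m' > 0"
    using shock_slope_strict_mono[OF g m'(1,2)] shock_slope_gt_kappa[OF g m'(1)] kappa_pos[OF g]
    by auto
  have D': "D = (m' - 1) * shock_slope \<gamma> m'"
    using m' velocity_drop_shock[OF g, of 1 m'] by simp
  have wider: "1 - m < m' - 1"
  proof (rule ccontr)
    assume "\<not> ?thesis"
    then have "(m' - 1) * shock_slope \<gamma> m' \<le> (1 - m) * shock_slope \<gamma> m'"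
      using slope' by (intro mult_right_mono) auto
    also have "\<dots> < (1 - m) * shock_slope \<gamma> z" using slope' m by simp
    finally show False using D D' by simp
  qed
  define J where "J = linear_field \<gamma> a b"
  have J: "J (x, w) = (a + b) * w + (b - a) * (\<kappa> * x)" for x w
    by (simp add: J_def linear_field_eq \<kappa>_def algebra_simps)
  have "shock_interaction \<gamma> (1, 0) (m, - D) (1, - 2 * D) (m', - D)"
    unfolding shock_interaction_def
  proof (intro conjI exI)
    show "wave_state \<gamma> Forward (m / 1) (1, 0) = (m, - D)"
      using m by (subst wave_state_forward[OF g]) (simp_all add: D_def)
    show "wave_state \<gamma> Backward (1 / m) (m, - D) = (1, - 2 * D)"
      using m by (subst wave_state_backward) (simp_all add: D_def)
    show "wave_state \<gamma> Backward (m' / 1) (1, 0) = (m', - D)"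
      using m' by (subst wave_state_backward) simp_all
    show "wave_state \<gamma> Forward (1 / m') (m', - D) = (1, - 2 * D)"
      using m' by (subst wave_state_forward[OF g]) simp_all
  qed (use m m' in \<open>auto simp: approaching_def\<close>)
  from ineq[OF this]
  have "\<bar>J (m', - D) - J (1, 0)\<bar> + \<bar>J (1, - 2 * D) - J (m', - D)\<bar>
      \<le> \<bar>J (m, - D) - J (1, 0)\<bar> + \<bar>J (1, - 2 * D) - J (m, - D)\<bar>" by (simp add: J_def)
  moreover define P Q Q' where "P = (a + b) * D" and "Q = (b - a) * (\<kappa> * (1 - m))"
    and "Q' = (b - a) * (\<kappa> * (m' - 1))"
  ultimately have ineq': "\<bar>- P + Q'\<bar> + \<bar>- P - Q'\<bar> \<le> \<bar>- P - Q\<bar> + \<bar>- P + Q\<bar>"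
    by (simp add: J algebra_simps)
  have absP: "\<bar>P\<bar> = A * D" using \<open>D > 0\<close> by (simp add: P_def A_def abs_mult)
  have absQ: "\<bar>Q\<bar> = B * (\<kappa> * (1 - m))" "\<bar>Q'\<bar> = B * (\<kappa> * (m' - 1))"
    using \<kappa> m m' by (simp_all add: Q_def Q'_def B_def abs_mult)
  have "A * shock_slope \<gamma> m' \<le> A * (\<kappa> + C * (z - 1)\<^sup>2)"
    using C(2)[of z] z slope' AB by (intro mult_left_mono) auto
  also have "\<dots> < B * \<kappa>" by (rule z)
  finally have "A * shock_slope \<gamma> m' * (m' - 1) < B * \<kappa> * (m' - 1)" using m' by simp
  then have "\<bar>P\<bar> < \<bar>Q'\<bar>" unfolding absP absQ D' by (simp add: algebra_simps)
  moreover have "\<bar>Q\<bar> < \<bar>Q'\<bar>" unfolding absQ using wider AB \<kappa> by simp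
  ultimately show False using ineq' by linarith
qed

section \<open>Nonexistence\<close>

lemma gradient_eq_0:
  assumes g: "\<gamma> > 1" and C2: "C2_on no_vacuum \<phi>" and tvd: "glimm_TVD \<gamma> \<phi>"
    and q: "R < q" "q < S"
  shows "partial_r \<phi> (q, S) = 0" "partial_s \<phi> (R, q) = 0"
proof -
  define a b where "a = partial_r \<phi> (q, S)" and "b = partial_s \<phi> (R, q)"
  note ineq = linear_field_shock_interaction[OF g C2 tvd q, folded a_def b_def]
  have "\<not> a * b < 0" using linear_field_head_on[OF g _ ineq] by blast
  then have "a = 0 \<and> b = 0" using linear_field_overtaking[OF g _ ineq] by auto
  then show "partial_r \<phi> (q, S) = 0" "partial_s \<phi> (R, q) = 0" by (auto simp: a_def b_def)
qed

theorem theorem5p2: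
  fixes \<gamma> :: real
  assumes "\<gamma> > 1"
  shows "\<not> (\<exists>\<phi> :: real \<times> real \<Rightarrow> real.
             C2_on no_vacuum \<phi> \<and> nondegenerate \<phi> \<and> glimm_TVD \<gamma> \<phi>)"
proof
  assume "\<exists>\<phi>. C2_on no_vacuum \<phi> \<and> nondegenerate \<phi> \<and> glimm_TVD \<gamma> \<phi>"
  then obtain \<phi> where \<phi>: "C2_on no_vacuum \<phi>" "nondegenerate \<phi>" "glimm_TVD \<gamma> \<phi>" by blast
  have "partial_r \<phi> p = 0 \<and> partial_s \<phi> p = 0" if p: "p \<in> no_vacuum" for p
  proof -
    obtain r s where rs: "p = (r, s)" "r < s" using p by (auto simp: no_vacuum_def)
    show ?thesis
      using gradient_eq_0(1)[OF assms \<phi>(1,3), of "r - 1" r s]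
        gradient_eq_0(2)[OF assms \<phi>(1,3), of r s "s + 1"] rs by auto
  qed
  then have "{p \<in> no_vacuum. partial_r \<phi> p \<noteq> 0 \<or> partial_s \<phi> p \<noteq> 0} = {}" by blast
  with \<phi>(2) have "no_vacuum = {}" unfolding nondegenerate_def by (simp only:) simp
  moreover have "(0, 1) \<in> no_vacuum" by (simp add: no_vacuum_def)
  ultimately show False by simp
qed

end
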